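(* Given an unweighted graph $G$ on $n$ vertices, accessible only through cut queries, it is possible to find a minimum cut of $G$ using $\tilde{O}(n^{4/3})$ cut queries in $2$ rounds. The algorithm is randomized and succeeds with probability $1-n^{-2}$.
   Context: Cut-query model: the input is a graph $G=(V,E,w)$ with $n=|V|$ and edge weights $w(e)>0$ (an unweighted graph has $w\equiv 1$). The algorithm can access $G$ only via queries that, given $S\subseteq V$, return $\mathrm{cut}_G(S)=\sum_{e\in E:\,|e\cap S|=1} w(e)$. An algorithm has round complexity $r$ if it issues its queries in $r$ rounds, where the queries of round $t$ may depend only on answers to queries of rounds $1,\dots,t-1$. Finding a minimum cut means outputting a set $\emptyset\neq S\subsetneq V$ minimizing $\mathrm{cut}_G(S)$, together with its value. $\tilde{O}(\cdot)$ hides factors polylogarithmic in $n$. *)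

theory Defs
  imports
    "HOL-Probability.Probability_Mass_Function"
    "HOL-Library.Landau_Symbols"
begin

definition is_graph :: "'v set \<Rightarrow> 'v set set \<Rightarrow> ('v set \<Rightarrow> real) \<Rightarrow> bool" where
  "is_graph V E w \<longleftrightarrow>
     finite V \<and> (\<forall>e\<in>E. e \<subseteq> V \<and> card e = 2) \<and> (\<forall>e\<in>E. w e > 0)"

definition unit_weight :: "'v set \<Rightarrow> real" where
  "unit_weight e = 1"

definition cut_value :: "'v set set \<Rightarrow> ('v set \<Rightarrow> real) \<Rightarrow> 'v set \<Rightarrow> real" where
  "cut_value E w S = (\<Sum>e\<in>{e\<in>E. card (e \<inter> S) = 1}. w e)"

definition is_min_cut :: "'v set \<Rightarrow> 'v set set \<Rightarrow> ('v set \<Rightarrow> real) \<Rightarrow> 'v set \<Rightarrow> bool" where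
  "is_min_cut V E w S \<longleftrightarrow>
     S \<noteq> {} \<and> S \<subset> V \<and> (\<forall>T. T \<noteq> {} \<and> T \<subset> V \<longrightarrow> cut_value E w S \<le> cut_value E w T)"

text \<open>
  A deterministic query algorithm either stops with an output or issues a whole round of
  queries at once. The continuation receives only the list of answers to these queries (in order),
  so that later rounds can depend on the input only through answers from earlier rounds.
\<close>

datatype ('v, 'o) query_alg =
    Output 'o
  | Round "'v set list" "real list \<Rightarrow> ('v, 'o) query_alg"

primrec run :: "('v set \<Rightarrow> real) \<Rightarrow> ('v, 'o) query_alg \<Rightarrow> 'o" where
  "run orc (Output x) = x"
| "run orc (Round Qs k) = run orc (k (map orc Qs))"

text \<open>The queries issued in an execution against the oracle, grouped by rounds.\<close>

primrec query_rounds :: "('v set \<Rightarrow> real) \<Rightarrow> ('v, 'o) query_alg \<Rightarrow> 'v set list list" where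
  "query_rounds orc (Output x) = []"
| "query_rounds orc (Round Qs k) = Qs # query_rounds orc (k (map orc Qs))"

definition round_count :: "('v set \<Rightarrow> real) \<Rightarrow> ('v, 'o) query_alg \<Rightarrow> nat" where
  "round_count orc A = length (query_rounds orc A)"

definition query_count :: "('v set \<Rightarrow> real) \<Rightarrow> ('v, 'o) query_alg \<Rightarrow> nat" where
  "query_count orc A = length (concat (query_rounds orc A))"

definition queries_within ::
  "'v set \<Rightarrow> ('v set \<Rightarrow> real) \<Rightarrow> ('v, 'o) query_alg \<Rightarrow> bool" where
  "queries_within V orc A \<longleftrightarrow> (\<forall>S\<in>set (concat (query_rounds orc A)). S \<subseteq> V)"

definition finds_min_cut ::
  "'v set \<Rightarrow> 'v set set \<Rightarrow> ('v set \<Rightarrow> real) \<Rightarrow> ('v, 'v set \<times> real) query_alg \<Rightarrow> bool" where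
  "finds_min_cut V E w A \<longleftrightarrow>
     (case run (cut_value E w) A of (S, c) \<Rightarrow> is_min_cut V E w S \<and> c = cut_value E w S)"

definition soft_O :: "(nat \<Rightarrow> real) \<Rightarrow> (nat \<Rightarrow> real) set" where
  "soft_O g = {f. \<exists>k::nat. f \<in> O(\<lambda>n. g n * ln (real n) ^ k)}"

end

(* Give every vertex v of high degree d, 2^j <= d < 2^(j+1), a random neighbour among the centres of
   level j, which are sampled with rate about (log n) / 2^j, and contract v into it.  With all degrees
   above n^(1/3) only about n^(2/3) stars arise, so all pairs of stars can be queried in the second
   round.  A vertex of low degree is not contracted; its whole neighbourhood is learned in the first
   round, because about k log n fixed sets B suffice to identify any set N of at most k vertices
   from the numbers |N Int B|.

   Suppose that no singleton is a minimum cut.  Then moving a vertex across a minimum cut does not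
   improve it, so at least half of its neighbours lie on its own side; and since the minimum cut
   value is at most every degree, the probabilities of being contracted across the cut sum up to
   O(1).  The choices being independent, the cut survives with constant probability, which
   O(log n) independent trials in the same two rounds amplify. *)

theory Submission
  imports Defs "HOL-Library.Discrete_Functions" "HOL-Probability.Product_PMF"
begin

section \<open>Cuts and neighbourhoods\<close>

text \<open>The exponent comes from balancing the rounds. With degree threshold \<open>s\<close>,
  learning neighbourhoods costs about n*s queries, and the number of stars is about n/s, so the
  second round costs about (n/s)^2; the two meet at s = n^(1/3). The levels serve sparse recovery.
  At one common sampling rate a vertex of degree near n would see about n^(2/3) centres, too many to
  identify cheaply; at the rate of its own level it sees O(log n) in expectation. Degrees are
  unknown when the first round is issued, so every vertex is queried against every level, and the
  answers tell afterwards which level matters. The analysis fixes a single minimum cut and needs no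
  union bound over cuts. Chernoff gives every high vertex at least b = O(log n) centres on its own
  side, while Markov bounds the total number of centres seen across the cut by O(b). Given such
  centres, the survival probability is a product of ratios g/(g+c) with g at least b, hence at least
  exp(-(sum of c)/b), a constant.\<close>

definition adj :: "'v set set \<Rightarrow> 'v \<Rightarrow> 'v \<Rightarrow> real" where
  "adj E x y = of_bool ({x, y} \<in> E)"

definition nbrs :: "'v set set \<Rightarrow> 'v \<Rightarrow> 'v set" where
  "nbrs E v = {u. {v, u} \<in> E}"

abbreviation cut :: "'v set set \<Rightarrow> 'v set \<Rightarrow> real" where
  "cut E \<equiv> cut_value E unit_weight"

abbreviation graph_on :: "'v set \<Rightarrow> 'v set set \<Rightarrow> bool" where
  "graph_on V E \<equiv> is_graph V E unit_weight"

lemma graph_onD: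
  assumes "graph_on V E"
  shows "finite V" "finite E" "\<And>e. e \<in> E \<Longrightarrow> e \<subseteq> V" "\<And>e. e \<in> E \<Longrightarrow> card e = 2"
proof -
  show *: "finite V" "\<And>e. e \<in> E \<Longrightarrow> e \<subseteq> V" "\<And>e. e \<in> E \<Longrightarrow> card e = 2"
    using assms by (auto simp: is_graph_def)
  have "E \<subseteq> Pow V" using * by blast
  then show "finite E" by (rule finite_subset) (simp add: *(1))
qed

lemma adj_commute: "adj E x y = adj E y x"
  by (simp add: adj_def insert_commute)

lemma nbrs_subset: "graph_on V E \<Longrightarrow> nbrs E v \<subseteq> V"
  using graph_onD(3)[of V E] by (auto simp: nbrs_def)

lemma finite_nbrs: "graph_on V E \<Longrightarrow> finite (nbrs E v)"
  by (rule finite_subset[OF nbrs_subset graph_onD(1)])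

lemma nbrs_irrefl: "graph_on V E \<Longrightarrow> v \<notin> nbrs E v"
  using graph_onD(4)[of V E "{v}"] by (auto simp: nbrs_def)

lemma adj_nbrs: "adj E x y = of_bool (y \<in> nbrs E x)"
  by (simp add: adj_def nbrs_def)

lemma sum_adj: "finite X \<Longrightarrow> (\<Sum>y\<in>X. adj E v y) = card (nbrs E v \<inter> X)"
  by (simp add: adj_nbrs Int_commute)

text \<open>Each crossing edge has exactly one orientation that leaves \<open>S\<close>. The
  resulting double sum is the form in which cuts of two graphs are later subtracted and
  regrouped.\<close>

lemma cut_eq_sum_adj:
  assumes G: "graph_on V E" and S: "S \<subseteq> V"
  shows "cut E S = (\<Sum>x\<in>S. \<Sum>y\<in>V - S. adj E x y)"
proof -
  note g = graph_onD[OF G]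
  have fS: "finite S" "finite (V - S)" using g(1) finite_subset[OF S] by simp_all
  let ?P = "{(x, y) \<in> S \<times> (V - S). {x, y} \<in> E}"
  let ?C = "{e \<in> E. card (e \<inter> S) = 1}"
  have "bij_betw (\<lambda>(x, y). {x, y}) ?P ?C"
  proof (rule bij_betwI')
    fix p q assume "p \<in> ?P" "q \<in> ?P"
    then show "((case p of (x, y) \<Rightarrow> {x, y}) = (case q of (x, y) \<Rightarrow> {x, y})) = (p = q)"
      by (auto simp: doubleton_eq_iff)
  next
    fix p assume "p \<in> ?P"
    then obtain x y where p: "p = (x, y)" "x \<in> S" "y \<in> V - S" "{x, y} \<in> E" by auto
    then have "{x, y} \<inter> S = {x}" by auto
    then show "(case p of (x, y) \<Rightarrow> {x, y}) \<in> ?C" using p by simp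
  next
    fix e assume e: "e \<in> ?C"
    then obtain x where x: "e \<inter> S = {x}" by (auto simp: card_1_singleton_iff)
    obtain a b where ab: "e = {a, b}" "a \<noteq> b" using g(4)[of e] e by (auto simp: card_2_iff)
    have "e \<subseteq> V" using g(3) e by blast
    have "x \<in> e" "x \<in> S" using x by auto
    then obtain y where "e = {x, y}" "x \<noteq> y" using ab by (metis insert_commute insertE singletonD)
    then have "y \<notin> S" "y \<in> V" using x \<open>e \<subseteq> V\<close> by auto
    then have "(x, y) \<in> ?P" using e \<open>x \<in> S\<close> \<open>e = {x, y}\<close> by simp
    then show "\<exists>p\<in>?P. e = (case p of (x, y) \<Rightarrow> {x, y})" using \<open>e = {x, y}\<close> by blast
  qed
  then have "cut E S = real (card ?P)"
    by (simp add: cut_value_def unit_weight_def bij_betw_same_card)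
  also have "\<dots> = (\<Sum>p\<in>S \<times> (V - S). of_bool ({fst p, snd p} \<in> E))"
  proof -
    have "?P = (S \<times> (V - S)) \<inter> {p. {fst p, snd p} \<in> E}" by auto
    then show ?thesis using fS by (simp only: of_bool_def sum.If_cases finite_cartesian_product) simp
  qed
  also have "\<dots> = (\<Sum>x\<in>S. \<Sum>y\<in>V - S. adj E x y)"
    by (simp add: sum.cartesian_product adj_def case_prod_unfold)
  finally show ?thesis .
qed

text \<open>An edge between \<open>A\<close> and \<open>B\<close> counts in both single cuts and not
  in the cut of the union; an edge from either set to the rest cancels. This identity is how cut
  answers become edge counts, in both rounds.\<close>

lemma sum_adj_disjoint_cut:
  assumes G: "graph_on V E" and "A \<subseteq> V" "B \<subseteq> V" "A \<inter> B = {}"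
  shows "2 * (\<Sum>x\<in>A. \<Sum>y\<in>B. adj E x y) = cut E A + cut E B - cut E (A \<union> B)"
proof -
  define R where "R = V - A - B"
  have f: "finite A" "finite B" "finite R"
    using finite_subset[OF _ graph_onD(1)[OF G]] assms(2,3) by (simp_all add: R_def graph_onD(1)[OF G])
  have V: "V - A = B \<union> R" "V - B = A \<union> R" "V - (A \<union> B) = R" and dis: "A \<inter> R = {}" "B \<inter> R = {}"
    using assms by (auto simp: R_def)
  have "cut E A = (\<Sum>x\<in>A. \<Sum>y\<in>B. adj E x y) + (\<Sum>x\<in>A. \<Sum>y\<in>R. adj E x y)"
    using f dis by (simp add: cut_eq_sum_adj[OF G \<open>A \<subseteq> V\<close>] V sum.union_disjoint sum.distrib)
  moreover have "cut E B = (\<Sum>x\<in>B. \<Sum>y\<in>A. adj E x y) + (\<Sum>x\<in>B. \<Sum>y\<in>R. adj E x y)"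
    using f dis by (simp add: cut_eq_sum_adj[OF G \<open>B \<subseteq> V\<close>] V sum.union_disjoint sum.distrib)
  moreover have "(\<Sum>x\<in>B. \<Sum>y\<in>A. adj E x y) = (\<Sum>x\<in>A. \<Sum>y\<in>B. adj E x y)"
    by (subst sum.swap) (simp only: adj_commute)
  moreover have "cut E (A \<union> B) = (\<Sum>x\<in>A. \<Sum>y\<in>R. adj E x y) + (\<Sum>x\<in>B. \<Sum>y\<in>R. adj E x y)"
    using f assms by (subst cut_eq_sum_adj[OF G]) (simp_all add: V sum.union_disjoint)
  ultimately show ?thesis by simp
qed

lemma cut_singleton:
  assumes "graph_on V E" "v \<in> V"
  shows "cut E {v} = card (nbrs E v)"
proof -
  have "nbrs E v \<inter> (V - {v}) = nbrs E v"
    using nbrs_subset[OF assms(1), of v] nbrs_irrefl[OF assms(1), of v] by blast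
  moreover have "cut E {v} = (\<Sum>y\<in>V - {v}. adj E v y)"
    by (subst cut_eq_sum_adj[OF assms(1)]) (simp_all add: assms(2))
  moreover have "finite (V - {v})" using graph_onD(1)[OF assms(1)] by simp
  ultimately show ?thesis by (metis sum_adj)
qed

text \<open>This fixes the shape of the first-round queries. A sampled set \<open>X\<close> may or
  may not contain \<open>v\<close>, so \<open>v\<close> is removed in one query and inserted in the
  other.\<close>

lemma card_nbrs_Int_cut:
  assumes G: "graph_on V E" and "v \<in> V" "X \<subseteq> V"
  shows "2 * real (card (nbrs E v \<inter> X)) = cut E {v} + cut E (X - {v}) - cut E (insert v X)"
proof -
  have "nbrs E v \<inter> X = nbrs E v \<inter> (X - {v})" using nbrs_irrefl[OF G, of v] by auto
  moreover have "finite X" using finite_subset[OF \<open>X \<subseteq> V\<close> graph_onD(1)[OF G]] .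
  ultimately have "real (card (nbrs E v \<inter> X)) = (\<Sum>x\<in>{v}. \<Sum>y\<in>X-{v}. adj E x y)"
    by (simp add: sum_adj)
  then show ?thesis
    using sum_adj_disjoint_cut[OF G, of "{v}" "X - {v}"] assms(2,3) by (simp add: subset_iff)
qed

section \<open>Sparse recovery\<close>

lemma nonseparating_subsets_le_half:
  assumes "finite V" "N \<subseteq> V" "N' \<subseteq> V" "N \<noteq> N'"
  shows "2 * card {B \<in> Pow V. card (N \<inter> B) = card (N' \<inter> B)} \<le> card (Pow V)"
proof -
  let ?U = "{B \<in> Pow V. card (N \<inter> B) = card (N' \<inter> B)}"
  obtain x where x: "x \<in> V" "(x \<in> N) \<noteq> (x \<in> N')" using assms by blast
  \<comment> \<open>Toggling a point of the symmetric difference destroys the equality.\<close>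
  let ?t = "\<lambda>B. if x \<in> B then B - {x} else insert x B"
  have inj: "inj_on ?t ?U"
  proof (rule inj_onI)
    fix B B' assume "?t B = ?t B'"
    then show "B = B'" by (cases "x \<in> B"; cases "x \<in> B'") auto
  qed
  have "?t ` ?U \<inter> ?U = {}"
  proof -
    have "?t B \<notin> ?U" if B: "B \<in> ?U" for B
    proof
      assume t: "?t B \<in> ?U"
      define C where "C = B - {x}"
      have fin: "finite (N \<inter> C)" "finite (N' \<inter> C)"
        using finite_subset[OF assms(2,1)] finite_subset[OF assms(3,1)] by simp_all
      have "card (N \<inter> C) = card (N' \<inter> C)" "card (N \<inter> insert x C) = card (N' \<inter> insert x C)"
        using B t by (cases "x \<in> B"; simp add: C_def insert_absorb)+
      moreover have "x \<notin> C" by (simp add: C_def)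
      ultimately show False using x fin by (cases "x \<in> N"; cases "x \<in> N'"; simp)
    qed
    then show ?thesis by blast
  qed
  moreover have "?t ` ?U \<union> ?U \<subseteq> Pow V" using x by auto
  ultimately have "card (?t ` ?U) + card ?U \<le> card (Pow V)"
    using assms(1) card_mono[of "Pow V" "?t ` ?U \<union> ?U"] by (subst card_Un_disjoint[symmetric]) simp_all
  then show ?thesis using card_image[OF inj] by simp
qed

text \<open>Averaging: each pair is left unseparated by at most half of all subsets of
  \<open>V\<close>, so by double counting some subset leaves at most half of the pairs
  unseparated.\<close>

lemma exists_halving_subset:
  assumes V: "finite V" and P: "finite P" "\<And>N N'. (N, N') \<in> P \<Longrightarrow> N \<subseteq> V \<and> N' \<subseteq> V \<and> N \<noteq> N'"
  shows "\<exists>B\<subseteq>V. 2 * card {(N, N') \<in> P. card (N \<inter> B) = card (N' \<inter> B)} \<le> card P"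
proof (rule ccontr)
  assume "\<not> ?thesis"
  then have *: "card P < 2 * card {p \<in> P. card (fst p \<inter> B) = card (snd p \<inter> B)}" if "B \<in> Pow V" for B
    using that by (auto simp: not_le case_prod_unfold)
  have "card (Pow V) * card P = (\<Sum>B\<in>Pow V. card P)" by simp
  also have "\<dots> < (\<Sum>B\<in>Pow V. 2 * card {p \<in> P. card (fst p \<inter> B) = card (snd p \<inter> B)})"
    using * V by (intro sum_strict_mono) auto
  also have "\<dots> = 2 * (\<Sum>B\<in>Pow V. \<Sum>p\<in>P. of_bool (card (fst p \<inter> B) = card (snd p \<inter> B)))"
    using P(1) by (simp add: sum_distrib_left Collect_conj_eq)
  also have "\<dots> = 2 * (\<Sum>p\<in>P. \<Sum>B\<in>Pow V. of_bool (card (fst p \<inter> B) = card (snd p \<inter> B)))"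
    by (subst sum.swap) simp
  also have "\<dots> = (\<Sum>p\<in>P. 2 * card {B \<in> Pow V. card (fst p \<inter> B) = card (snd p \<inter> B)})"
    using V by (simp add: sum_distrib_left Collect_conj_eq Pow_def)
  also have "\<dots> \<le> (\<Sum>p\<in>P. card (Pow V))"
    using nonseparating_subsets_le_half[OF V] P(2) by (intro sum_mono) fastforce
  finally show False by (simp add: mult.commute)
qed

text \<open>Greedy choice: every new set halves the number of unseparated pairs, and starting
  strictly below \<open>2 ^ t\<close> leaves none after \<open>t\<close> steps.\<close>

lemma exists_separating_list:
  assumes V: "finite V"
  shows "finite P \<Longrightarrow> (\<And>N N'. (N, N') \<in> P \<Longrightarrow> N \<subseteq> V \<and> N' \<subseteq> V \<and> N \<noteq> N') \<Longrightarrow> card P < 2 ^ t \<Longrightarrow>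
    \<exists>Bs. length Bs = t \<and> (\<forall>B\<in>set Bs. B \<subseteq> V) \<and>
      (\<forall>(N, N')\<in>P. \<exists>B\<in>set Bs. card (N \<inter> B) \<noteq> card (N' \<inter> B))"
proof (induction t arbitrary: P)
  case 0
  then show ?case by simp
next
  case (Suc t)
  obtain B where B: "B \<subseteq> V" "2 * card {(N, N') \<in> P. card (N \<inter> B) = card (N' \<inter> B)} \<le> card P"
    using exists_halving_subset[OF V Suc.prems(1,2)] by blast
  let ?P = "{(N, N') \<in> P. card (N \<inter> B) = card (N' \<inter> B)}"
  have "finite ?P" by (rule finite_subset[OF _ Suc.prems(1)]) auto
  moreover have "card ?P < 2 ^ t" using B(2) Suc.prems(3) by simp
  ultimately obtain Bs where "length Bs = t" "\<forall>B\<in>set Bs. B \<subseteq> V"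
      "\<forall>(N, N')\<in>?P. \<exists>B\<in>set Bs. card (N \<inter> B) \<noteq> card (N' \<inter> B)"
    using Suc.IH[of ?P] Suc.prems(2) by (smt (verit, del_insts) case_prodD mem_Collect_eq)
  then show ?case using B(1) by (intro exI[of _ "B # Bs"]) fastforce
qed

text \<open>A small set is coded by a list of length exactly \<open>s\<close>, padded with
  \<open>None\<close>; the padding symbol is the extra 1 in the base.\<close>

lemma card_small_subsets_le:
  assumes "finite V"
  shows "card {N \<in> Pow V. card N \<le> s} \<le> (card V + 1) ^ s"
proof -
  let ?A = "insert None (Some ` V)"
  let ?L = "{xs. set xs \<subseteq> ?A \<and> length xs = s}"
  have "{N \<in> Pow V. card N \<le> s} \<subseteq> (\<lambda>xs. {u. Some u \<in> set xs}) ` ?L"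
  proof
    fix N assume N: "N \<in> {N \<in> Pow V. card N \<le> s}"
    then have "finite N" using assms finite_subset by auto
    then obtain ys where ys: "set ys = N" "distinct ys"
      using finite_distinct_list by blast
    let ?xs = "map Some ys @ replicate (s - card N) None"
    have "length ?xs = s" using N ys distinct_card[of ys] by simp
    moreover have "set ?xs \<subseteq> ?A" using N ys by auto
    moreover have "N = {u. Some u \<in> set ?xs}" using ys by auto
    ultimately show "N \<in> (\<lambda>xs. {u. Some u \<in> set xs}) ` ?L" by blast
  qed
  moreover have "finite ?A" using assms by simp
  ultimately have "card {N \<in> Pow V. card N \<le> s} \<le> card ?L"
    by (intro surj_card_le finite_lists_length_eq)
  also have "\<dots> = card ?A ^ s" using assms by (intro card_lists_length_eq) simp
  also have "card ?A = card V + 1" using assms by (simp add: card_image card_insert_if image_iff)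
  finally show ?thesis .
qed

text \<open>There are at most \<open>2 ^ (2 * s * L)\<close> pairs of small sets; one further set
  provides the strict inequality for the greedy choice. Adding \<open>V\<close> itself reveals the
  cardinality, so \<open>N'\<close> needs no size bound: a competing graph is not known to be
  sparse.\<close>

lemma exists_sparse_recovery:
  assumes V: "finite V" and L: "card V + 1 \<le> 2 ^ L"
  shows "\<exists>Bs. length Bs = 2 * s * L + 2 \<and> V \<in> set Bs \<and> (\<forall>B\<in>set Bs. B \<subseteq> V) \<and>
    (\<forall>N N'. N \<subseteq> V \<longrightarrow> N' \<subseteq> V \<longrightarrow> card N \<le> s \<longrightarrow>
      (\<forall>B\<in>set Bs. card (N \<inter> B) = card (N' \<inter> B)) \<longrightarrow> N = N')"
proof -
  let ?F = "{N \<in> Pow V. card N \<le> s}"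
  define P where "P = {(N, N') \<in> ?F \<times> ?F. N \<noteq> N'}"
  have fF: "finite ?F" using V by simp
  have "P \<subseteq> ?F \<times> ?F" by (auto simp: P_def)
  then have "card P \<le> card ?F * card ?F"
    using fF by (simp only: card_cartesian_product[symmetric]) (rule card_mono, simp_all)
  also have "\<dots> \<le> (2 ^ L) ^ s * (2 ^ L) ^ s"
    using card_small_subsets_le[OF V, of s] power_mono[OF L, of s] by (intro mult_mono) auto
  also have "\<dots> = 2 ^ (2 * s * L)" by (simp add: mult.commute flip: power_mult power_add)
  also have "\<dots> < (2::nat) ^ (2 * s * L + 1)" by simp
  finally have "card P < 2 ^ (2 * s * L + 1)" .
  moreover have "finite P" using fF by (intro finite_subset[OF \<open>P \<subseteq> _\<close>]) simp
  ultimately have "\<exists>Bs. length Bs = 2 * s * L + 1 \<and> (\<forall>B\<in>set Bs. B \<subseteq> V) \<and>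
      (\<forall>(N, N')\<in>P. \<exists>B\<in>set Bs. card (N \<inter> B) \<noteq> card (N' \<inter> B))"
    by (intro exists_separating_list[OF V]) (auto simp: P_def)
  then obtain Bs where Bs: "length Bs = 2 * s * L + 1" "\<forall>B\<in>set Bs. B \<subseteq> V"
    "\<forall>(N, N')\<in>P. \<exists>B\<in>set Bs. card (N \<inter> B) \<noteq> card (N' \<inter> B)"
    by blast
  have "N = N'" if "N \<subseteq> V" "N' \<subseteq> V" "card N \<le> s"
    "\<forall>B\<in>set (V # Bs). card (N \<inter> B) = card (N' \<inter> B)" for N N'
  proof (rule ccontr)
    assume "N \<noteq> N'"
    have "card N' = card N" using that by (simp add: Int_absorb2)
    with that \<open>N \<noteq> N'\<close> have "(N, N') \<in> P" by (simp add: P_def)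
    then show False using Bs(3) that(4) by auto
  qed
  then show ?thesis using Bs(1,2) by (intro exI[of _ "V # Bs"]) auto
qed

section \<open>Two-round algorithms from independent trials\<close>

lemma prob_bind_pmf_ge:
  assumes "a \<le> measure_pmf.prob p G" "0 \<le> b" "\<And>x. x \<in> G \<Longrightarrow> b \<le> measure_pmf.prob (K x) A"
  shows "a * b \<le> measure_pmf.prob (bind_pmf p K) A"
proof -
  have "ennreal (measure_pmf.prob p G * b) = (\<integral>\<^sup>+x. ennreal b * indicator G x \<partial>p)"
    using assms(2) by (simp add: nn_integral_cmult measure_pmf.emeasure_eq_measure ennreal_mult mult.commute)
  also have "\<dots> \<le> (\<integral>\<^sup>+x. emeasure (K x) A \<partial>p)"
    using assms(3) by (intro nn_integral_mono)
      (auto simp: indicator_def measure_pmf.emeasure_eq_measure intro!: ennreal_leI)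
  also have "\<dots> = ennreal (measure_pmf.prob (bind_pmf p K) A)"
    by (simp flip: measure_pmf.emeasure_eq_measure)
  finally have "measure_pmf.prob p G * b \<le> measure_pmf.prob (bind_pmf p K) A"
    by simp
  moreover have "a * b \<le> measure_pmf.prob p G * b" using assms(1,2) by (rule mult_right_mono)
  ultimately show ?thesis by linarith
qed

lemma prob_Ex_Pi_pmf_ge:
  assumes "c \<le> measure_pmf.prob P G" "c \<le> 1"
  shows "1 - (1 - c) ^ T \<le> measure_pmf.prob (Pi_pmf {..<T} d (\<lambda>_. P)) {\<omega>. \<exists>i<T. \<omega> i \<in> G}"
proof -
  let ?D = "Pi_pmf {..<T} d (\<lambda>_. P)"
  have "- {\<omega>. \<exists>i<T. \<omega> i \<in> G} = Pi {..<T} (\<lambda>_. - G)" by (auto simp: Pi_def)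
  then have "measure_pmf.prob ?D (- {\<omega>. \<exists>i<T. \<omega> i \<in> G}) = (1 - measure_pmf.prob P G) ^ T"
    using measure_pmf.prob_compl[of G P]
    by (simp only: measure_Pi_pmf_Pi finite_lessThan) (simp add: Compl_eq_Diff_UNIV)
  also have "\<dots> \<le> (1 - c) ^ T" using assms(1) by (intro power_mono) auto
  finally show ?thesis
    using measure_pmf.prob_compl[of "{\<omega>. \<exists>i<T. \<omega> i \<in> G}" ?D] by (simp add: Compl_eq_Diff_UNIV)
qed

definition agree :: "'v set list \<Rightarrow> 'v set set \<Rightarrow> 'v set set \<Rightarrow> bool" where
  "agree Qs E E' \<longleftrightarrow> map (cut E) Qs = map (cut E') Qs"

lemma agree_iff: "agree Qs E E' \<longleftrightarrow> (\<forall>S\<in>set Qs. cut E S = cut E' S)"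
  by (simp add: agree_def)

text \<open>Computation is free in the query model, so decoding may simply pick any graph that is
  consistent with the answers received so far.\<close>

definition decode_alg ::
  "'v set \<Rightarrow> 'v set list \<Rightarrow> ('v set set \<Rightarrow> 'v set list) \<Rightarrow> ('v set set \<Rightarrow> 'v set set) \<Rightarrow>
    ('v, 'v set \<times> real) query_alg" where
  "decode_alg V Q1 Q2 Cand = Round Q1 (\<lambda>a1.
     let E1 = (SOME E. graph_on V E \<and> map (cut E) Q1 = a1)
     in Round (Q2 E1) (\<lambda>a2.
       let E2 = (SOME E. graph_on V E \<and> map (cut E) Q1 = a1 \<and> map (cut E) (Q2 E1) = a2);
           S = arg_min_on (cut E2) (Cand E2)
       in Output (S, cut E2 S)))"

text \<open>Neither consistent graph has to equal \<open>E\<close>. The first only serves to compute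
  the second-round queries, which by \<open>Q2\<close> are those of \<open>E\<close>; the second
  only serves to evaluate the candidates, which by \<open>Cand\<close> and \<open>det\<close> have
  the same family and the same values as in \<open>E\<close>.\<close>

lemma decode_alg_correct:
  fixes V :: "'v set"
  assumes G: "graph_on V E"
    and Q2: "\<And>E'. graph_on V E' \<Longrightarrow> agree Q1 E E' \<Longrightarrow> Q2 E = Q2 E'"
    and Cand: "\<And>E'. graph_on V E' \<Longrightarrow> agree Q1 E E' \<Longrightarrow> Cand E = Cand E'"
    and det: "\<And>E' S. graph_on V E' \<Longrightarrow> agree Q1 E E' \<Longrightarrow> agree (Q2 E) E E' \<Longrightarrow>
      S \<in> Cand E \<Longrightarrow> cut E S = cut E' S"
    and proper: "\<And>S. S \<in> Cand E \<Longrightarrow> S \<noteq> {} \<and> S \<subset> V"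
    and ne: "Cand E \<noteq> {}"
  shows "query_rounds (cut E) (decode_alg V Q1 Q2 Cand) = [Q1, Q2 E]"
    and "S \<in> Cand E \<Longrightarrow> is_min_cut V E unit_weight S \<Longrightarrow>
      finds_min_cut V E unit_weight (decode_alg V Q1 Q2 Cand)"
proof -
  define E1 where "E1 = (SOME E'. graph_on V E' \<and> map (cut E') Q1 = map (cut E) Q1)"
  have "graph_on V E1 \<and> map (cut E1) Q1 = map (cut E) Q1"
    unfolding E1_def by (rule someI[of _ E]) (simp add: G)
  then have E1: "graph_on V E1" "agree Q1 E E1" by (auto simp: agree_def)
  then have q: "Q2 E1 = Q2 E" using Q2[of E1] by simp
  define E2 where "E2 = (SOME E'. graph_on V E' \<and> map (cut E') Q1 = map (cut E) Q1 \<and>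
    map (cut E') (Q2 E) = map (cut E) (Q2 E))"
  have "graph_on V E2 \<and> map (cut E2) Q1 = map (cut E) Q1 \<and> map (cut E2) (Q2 E) = map (cut E) (Q2 E)"
    unfolding E2_def by (rule someI[of _ E]) (simp add: G)
  then have E2: "graph_on V E2" "agree Q1 E E2" "agree (Q2 E) E E2" by (auto simp: agree_def)
  show "query_rounds (cut E) (decode_alg V Q1 Q2 Cand) = [Q1, Q2 E]"
    by (simp add: decode_alg_def Let_def q del: map_eq_conv flip: E1_def)
  have c: "Cand E2 = Cand E" using Cand[of E2] E2 by simp
  define X where "X = arg_min_on (cut E2) (Cand E)"
  have "finite V" using graph_onD(1)[OF G] .
  then have fin: "finite (Cand E)" using proper by (intro finite_subset[of "Cand E" "Pow V"]) auto
  have X: "X \<in> Cand E" "\<And>S. S \<in> Cand E \<Longrightarrow> cut E2 X \<le> cut E2 S"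
    using arg_min_if_finite[OF fin ne, of "cut E2"] by (auto simp: X_def not_less)
  have r: "run (cut E) (decode_alg V Q1 Q2 Cand) = (X, cut E2 X)"
    by (simp add: decode_alg_def Let_def q c X_def del: map_eq_conv flip: E1_def E2_def)
  have eq: "cut E2 S = cut E S" if "S \<in> Cand E" for S
    using det[OF E2 that] by simp
  assume S: "S \<in> Cand E" "is_min_cut V E unit_weight S"
  have "cut E X \<le> cut E S" using X S eq by metis
  then have "is_min_cut V E unit_weight X"
    using S(2) proper[OF X(1)] unfolding is_min_cut_def by (meson order_trans)
  then show "finds_min_cut V E unit_weight (decode_alg V Q1 Q2 Cand)"
    by (simp add: finds_min_cut_def r eq[OF X(1)])
qed

text \<open>The trials run in parallel: first rounds are concatenated, and so are second rounds,
  which keeps the round count at 2. Every candidate is evaluated exactly thanks to the queries of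
  its own trial, so one successful trial suffices and failures multiply.\<close>

lemma two_round_boost:
  fixes V :: "'v set" and P :: "'r pmf"
    and q1 :: "'r \<Rightarrow> 'v set list" and q2 :: "'r \<Rightarrow> 'v set set \<Rightarrow> 'v set list"
    and cand :: "'r \<Rightarrow> 'v set set \<Rightarrow> 'v set set"
  assumes q1: "\<And>r. length (q1 r) \<le> m1" "\<And>r S. S \<in> set (q1 r) \<Longrightarrow> S \<subseteq> V"
    and q2: "\<And>r E. length (q2 r E) \<le> m2" "\<And>r E S. S \<in> set (q2 r E) \<Longrightarrow> S \<subseteq> V"
    and inv: "\<And>r E E'. graph_on V E \<Longrightarrow> graph_on V E' \<Longrightarrow> agree (q1 r) E E' \<Longrightarrow> q2 r E = q2 r E'"
      "\<And>r E E'. graph_on V E \<Longrightarrow> graph_on V E' \<Longrightarrow> agree (q1 r) E E' \<Longrightarrow> cand r E = cand r E'"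
    and det: "\<And>r E E' S. graph_on V E \<Longrightarrow> graph_on V E' \<Longrightarrow> agree (q1 r) E E' \<Longrightarrow>
      agree (q2 r E) E E' \<Longrightarrow> S \<in> cand r E \<Longrightarrow> cut E S = cut E' S"
    and proper: "\<And>r E S. S \<in> cand r E \<Longrightarrow> S \<noteq> {} \<and> S \<subset> V"
    and ne: "\<And>r E. cand r E \<noteq> {}"
    and succ: "\<And>E. graph_on V E \<Longrightarrow>
      c \<le> measure_pmf.prob P {r. \<exists>S\<in>cand r E. is_min_cut V E unit_weight S}"
    and c: "c \<le> 1" and T: "0 < T"
  shows "\<exists>D. \<forall>E. graph_on V E \<longrightarrow>
    (\<forall>A\<in>set_pmf D. queries_within V (cut E) A \<and> round_count (cut E) A \<le> 2 \<and>
      query_count (cut E) A \<le> T * (m1 + m2)) \<and>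
    measure_pmf.prob D {A. finds_min_cut V E unit_weight A} \<ge> 1 - (1 - c) ^ T"
proof -
  define Q1 where "Q1 = (\<lambda>\<omega>. concat (map (\<lambda>i. q1 (\<omega> i)) [0..<T]))"
  define Q2 where "Q2 = (\<lambda>\<omega> E. concat (map (\<lambda>i. q2 (\<omega> i) E) [0..<T]))"
  define Cand where "Cand = (\<lambda>\<omega> E. \<Union>i<T. cand (\<omega> i) E)"
  define alg where "alg = (\<lambda>\<omega>. decode_alg V (Q1 \<omega>) (Q2 \<omega>) (Cand \<omega>))"
  define D where "D = Pi_pmf {..<T} undefined (\<lambda>_. P)"
  have ag1: "agree (q1 (\<omega> i)) E E'" if "agree (Q1 \<omega>) E E'" "i < T" for \<omega> i E E'
    using that by (auto simp: agree_iff Q1_def)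
  have ag2: "agree (q2 (\<omega> i) E) E E'" if "agree (Q2 \<omega> E) E E'" "i < T" for \<omega> i E E'
    using that by (auto simp: agree_iff Q2_def)
  have len: "length (concat (map f [0..<T])) \<le> T * m" if "\<And>i. length (f i) \<le> m" for f :: "nat \<Rightarrow> 'v set list" and m
  proof -
    have "length (concat (map f [0..<T])) = (\<Sum>i<T. length (f i))"
      by (simp add: length_concat o_def sum_list_sum_nth atLeast0LessThan)
    also have "\<dots> \<le> (\<Sum>i<T. m)" using that by (intro sum_mono)
    finally show ?thesis by simp
  qed
  have "(\<forall>A\<in>set_pmf (map_pmf alg D). queries_within V (cut E) A \<and> round_count (cut E) A \<le> 2 \<and>
      query_count (cut E) A \<le> T * (m1 + m2)) \<and>
    measure_pmf.prob (map_pmf alg D) {A. finds_min_cut V E unit_weight A} \<ge> 1 - (1 - c) ^ T"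
    if G: "graph_on V E" for E
  proof -
    have Q2_inv: "Q2 \<omega> E = Q2 \<omega> E'" if "graph_on V E'" "agree (Q1 \<omega>) E E'" for \<omega> E'
      unfolding Q2_def using inv(1)[OF G that(1) ag1[OF that(2)]]
      by (intro arg_cong[of _ _ concat] map_cong) auto
    have Cand_inv: "Cand \<omega> E = Cand \<omega> E'" if "graph_on V E'" "agree (Q1 \<omega>) E E'" for \<omega> E'
      unfolding Cand_def using inv(2)[OF G that(1) ag1[OF that(2)]] by (intro SUP_cong) auto
    have Cand_det: "cut E S = cut E' S"
      if a: "graph_on V E'" "agree (Q1 \<omega>) E E'" "agree (Q2 \<omega> E) E E'" "S \<in> Cand \<omega> E" for \<omega> E' S
    proof -
      obtain i where "i < T" "S \<in> cand (\<omega> i) E" using a(4) by (auto simp: Cand_def)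
      then show ?thesis using det[OF G a(1) ag1[OF a(2)] ag2[OF a(3)]] by blast
    qed
    have Cand_proper: "S \<noteq> {} \<and> S \<subset> V" if "S \<in> Cand \<omega> E" for \<omega> S
      using that proper by (auto simp: Cand_def)
    have Cand_ne: "Cand \<omega> E \<noteq> {}" for \<omega> using ne T by (auto simp: Cand_def)
    have rounds: "query_rounds (cut E) (alg \<omega>) = [Q1 \<omega>, Q2 \<omega> E]" for \<omega>
      unfolding alg_def
      by (rule decode_alg_correct(1)[OF G, where ?Q1.0 = "Q1 \<omega>" and ?Q2.0 = "Q2 \<omega>" and Cand = "Cand \<omega>",
            OF Q2_inv Cand_inv Cand_det Cand_proper Cand_ne])
    have finds: "finds_min_cut V E unit_weight (alg \<omega>)"
      if "S \<in> Cand \<omega> E" "is_min_cut V E unit_weight S" for \<omega> S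
      unfolding alg_def
      by (rule decode_alg_correct(2)[OF G, where ?Q1.0 = "Q1 \<omega>" and ?Q2.0 = "Q2 \<omega>" and Cand = "Cand \<omega>",
            OF Q2_inv Cand_inv Cand_det Cand_proper Cand_ne that])
    have "queries_within V (cut E) (alg \<omega>) \<and> round_count (cut E) (alg \<omega>) \<le> 2 \<and>
        query_count (cut E) (alg \<omega>) \<le> T * (m1 + m2)" for \<omega>
    proof (intro conjI)
      show "queries_within V (cut E) (alg \<omega>)"
        unfolding queries_within_def rounds by (auto simp: Q1_def Q2_def dest!: q1(2) q2(2))
      show "round_count (cut E) (alg \<omega>) \<le> 2" by (simp add: round_count_def rounds)
      have "length (Q1 \<omega>) \<le> T * m1" "length (Q2 \<omega> E) \<le> T * m2"
        unfolding Q1_def Q2_def using q1(1) q2(1) by (intro len; simp)+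
      then show "query_count (cut E) (alg \<omega>) \<le> T * (m1 + m2)"
        by (simp add: query_count_def rounds algebra_simps)
    qed
    moreover have "1 - (1 - c) ^ T \<le> measure_pmf.prob (map_pmf alg D) {A. finds_min_cut V E unit_weight A}"
    proof -
      let ?G = "{r. \<exists>S\<in>cand r E. is_min_cut V E unit_weight S}"
      have "1 - (1 - c) ^ T \<le> measure_pmf.prob D {\<omega>. \<exists>i<T. \<omega> i \<in> ?G}"
        unfolding D_def by (rule prob_Ex_Pi_pmf_ge[OF succ[OF G] c])
      also have "\<dots> \<le> measure_pmf.prob D (alg -` {A. finds_min_cut V E unit_weight A})"
        using finds by (intro measure_pmf.finite_measure_mono) (auto simp: Cand_def)
      finally show ?thesis by simp
    qed
    ultimately show ?thesis by simp
  qed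
  then show ?thesis by blast
qed

section \<open>Star contraction\<close>

text \<open>No probability enters here: the locale treats one fixed trial. \<open>s\<close> is both
  the degree threshold and the sparsity that \<open>Bs\<close> resolves, and \<open>m\<close> caps
  the number of centres.\<close>

locale star_contraction =
  fixes V :: "nat set" and s m L :: nat and Bs :: "nat set list"
  assumes finite_V: "finite V" and card_V_ge: "2 \<le> card V" and card_V_less: "card V < 2 ^ L"
    and Bs_V: "V \<in> set Bs" and Bs_subset: "B \<in> set Bs \<Longrightarrow> B \<subseteq> V"
    and recovery: "\<lbrakk>N \<subseteq> V; N' \<subseteq> V; card N \<le> s; \<forall>B\<in>set Bs. card (N \<inter> B) = card (N' \<inter> B)\<rbrakk> \<Longrightarrow> N = N'"
begin

text \<open>A trial is a pair \<open>(R, \<rho>)\<close>: \<open>R (j, u)\<close> says that \<open>u\<close> is a centre of level \<open>j\<close>, and a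
  high-degree vertex \<open>v\<close> whose neighbours among the centres of its level form the set \<open>N\<close> is
  contracted into \<open>\<rho> (v, N)\<close>.\<close>

type_synonym trial = "(nat \<times> nat \<Rightarrow> bool) \<times> (nat \<times> nat set \<Rightarrow> nat)"

text \<open>Level \<open>j\<close> serves degrees from \<open>2 ^ j\<close> up to
  \<open>2 ^ Suc j\<close>. The second condition discards levels that no degree above
  \<open>s\<close> can reach; it is what later bounds the sampling rates by a multiple of
  \<open>1 / s\<close>.\<close>

definition levels :: "nat set" where
  "levels = {j. j < L \<and> s < 2 ^ Suc j}"

definition level :: "(nat \<times> nat \<Rightarrow> bool) \<Rightarrow> nat \<Rightarrow> nat set" where
  "level R j = {u \<in> V. R (j, u)}"

definition centers :: "(nat \<times> nat \<Rightarrow> bool) \<Rightarrow> nat set" where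
  "centers R = (\<Union>j\<in>levels. level R j)"

definition high :: "nat set set \<Rightarrow> nat \<Rightarrow> bool" where
  "high E v \<longleftrightarrow> s < card (nbrs E v)"

definition lv :: "nat set set \<Rightarrow> nat \<Rightarrow> nat" where
  "lv E v = floor_log (card (nbrs E v))"

definition hits :: "(nat \<times> nat \<Rightarrow> bool) \<Rightarrow> nat set set \<Rightarrow> nat \<Rightarrow> nat set" where
  "hits R E v = nbrs E v \<inter> level R (lv E v)"

text \<open>A usability test that first-round answers decide. The cap \<open>m\<close> makes the
  query bound hold in every execution, not just with high probability; the cap \<open>s\<close>
  makes the hits recoverable.\<close>

definition ok :: "trial \<Rightarrow> nat set set \<Rightarrow> bool" where
  "ok r E \<longleftrightarrow> card (centers (fst r)) \<le> m \<and>
    (\<forall>v\<in>V. high E v \<longrightarrow> card (hits (fst r) E v) \<le> s \<and> snd r (v, hits (fst r) E v) \<in> hits (fst r) E v)"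

definition rep :: "trial \<Rightarrow> nat set set \<Rightarrow> nat \<Rightarrow> nat" where
  "rep r E v = (if high E v \<and> v \<notin> centers (fst r) then snd r (v, hits (fst r) E v) else v)"

definition fiber :: "trial \<Rightarrow> nat set set \<Rightarrow> nat \<Rightarrow> nat set" where
  "fiber r E a = {v \<in> V. rep r E v = a}"

text \<open>\<open>X = V\<close> yields the degrees and the low-degree neighbourhoods. The other
  \<open>X\<close> run through all levels, because the relevant one depends on a degree that is not
  known yet.\<close>

definition queries1 :: "trial \<Rightarrow> nat set list" where
  "queries1 r = concat (map (\<lambda>v. concat (map (\<lambda>X. concat (map
     (\<lambda>B. [{v}, X \<inter> B - {v}, insert v (X \<inter> B)]) Bs)) (V # map (level (fst r)) [0..<L])))
     (sorted_list_of_set V))"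

text \<open>The diagonal pairs give the cut of a single fiber, which is needed to turn the cut of a
  union of two fibers into an edge count.\<close>

definition queries2 :: "trial \<Rightarrow> nat set set \<Rightarrow> nat set list" where
  "queries2 r E = (if ok r E then
     concat (map (\<lambda>a. map (\<lambda>b. fiber r E a \<union> fiber r E b) (sorted_list_of_set (centers (fst r))))
       (sorted_list_of_set (centers (fst r)))) else [])"

text \<open>Singletons handle graphs in which one of them is a minimum cut, and keep the family
  nonempty when the trial fails. The remaining candidates are the proper sets that split no
  star.\<close>

definition candidates :: "trial \<Rightarrow> nat set set \<Rightarrow> nat set set" where
  "candidates r E = (\<lambda>v. {v}) ` V \<union>
     (if ok r E then {S. S \<noteq> {} \<and> S \<subset> V \<and> (\<forall>v\<in>V. v \<in> S \<longleftrightarrow> rep r E v \<in> S)} else {})"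

lemma level_subset: "level R j \<subseteq> V"
  by (auto simp: level_def)

lemma centers_subset: "centers R \<subseteq> V"
  by (auto simp: centers_def level_def)

lemma finite_centers: "finite (centers R)"
  by (rule finite_subset[OF centers_subset finite_V])

lemma set_queries1:
  "set (queries1 r) = (\<Union>v\<in>V. \<Union>X\<in>insert V (level (fst r) ` {..<L}). \<Union>B\<in>set Bs.
     {{v}, X \<inter> B - {v}, insert v (X \<inter> B)})"
  unfolding queries1_def
  by (simp only: set_concat set_map image_image list.set set_upt atLeast0LessThan
      sorted_list_of_set.set_sorted_key_list_of_set[OF finite_V])

lemma length_queries1: "length (queries1 r) = card V * ((1 + L) * (3 * length Bs))"
  by (simp add: queries1_def length_concat comp_def sum_list_triv algebra_simps)

lemma queries1_subset:
  assumes "S \<in> set (queries1 r)"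
  shows "S \<subseteq> V"
proof -
  obtain v X B where "v \<in> V" "B \<in> set Bs" "S \<in> {{v}, X \<inter> B - {v}, insert v (X \<inter> B)}"
    using assms unfolding set_queries1 by blast
  then show ?thesis using Bs_subset[of B] by auto
qed

lemma length_queries2: "length (queries2 r E) \<le> m * m"
  by (simp add: queries2_def ok_def length_concat comp_def sum_list_triv mult_le_mono)

lemma queries2_subset: "S \<in> set (queries2 r E) \<Longrightarrow> S \<subseteq> V"
  by (auto simp: queries2_def fiber_def split: if_splits)

lemma candidates_proper: "S \<in> candidates r E \<Longrightarrow> S \<noteq> {} \<and> S \<subset> V"
  using card_V_ge by (auto simp: candidates_def split: if_splits)

lemma candidates_nonempty: "candidates r E \<noteq> {}"
  using card_V_ge by (auto simp: candidates_def)

section \<open>What the first-round answers determine\<close>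

text \<open>The queries for \<open>v\<close>, \<open>X\<close> and \<open>B\<close> fix the number
  of neighbours of \<open>v\<close> in \<open>X\<close> and \<open>B\<close>, and the sets
  \<open>B\<close> then identify the neighbours in \<open>X\<close> if there are at most
  \<open>s\<close> of them in \<open>E\<close>. The claims are the cases \<open>X = V\<close> and
  \<open>X\<close> a level.\<close>

lemma agree_nbrs:
  assumes G: "graph_on V E" "graph_on V E'" and ag: "agree (queries1 r) E E'" and v: "v \<in> V"
  shows "card (nbrs E v) = card (nbrs E' v)"
    and "card (nbrs E v) \<le> s \<Longrightarrow> nbrs E v = nbrs E' v"
    and "j < L \<Longrightarrow> card (nbrs E v \<inter> level (fst r) j) \<le> s \<Longrightarrow>
      nbrs E v \<inter> level (fst r) j = nbrs E' v \<inter> level (fst r) j"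
proof -
  have eq: "card (nbrs E v \<inter> (X \<inter> B)) = card (nbrs E' v \<inter> (X \<inter> B))"
    if X: "X \<in> insert V (level (fst r) ` {..<L})" and B: "B \<in> set Bs" for X B
  proof -
    have "cut E T = cut E' T" if "T \<in> {{v}, X \<inter> B - {v}, insert v (X \<inter> B)}" for T
      using ag v X B that unfolding agree_iff set_queries1 by blast
    moreover have "X \<inter> B \<subseteq> V" using Bs_subset[OF B] by blast
    ultimately show ?thesis
      using card_nbrs_Int_cut[OF G(1) v, of "X \<inter> B"] card_nbrs_Int_cut[OF G(2) v, of "X \<inter> B"] by simp
  qed
  have rec: "nbrs E v \<inter> X = nbrs E' v \<inter> X"
    if X: "X \<in> insert V (level (fst r) ` {..<L})" and "card (nbrs E v \<inter> X) \<le> s" for X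
  proof (rule recovery)
    show "nbrs E v \<inter> X \<subseteq> V" "nbrs E' v \<inter> X \<subseteq> V"
      using nbrs_subset[OF G(1), of v] nbrs_subset[OF G(2), of v] by auto
    show "\<forall>B\<in>set Bs. card (nbrs E v \<inter> X \<inter> B) = card (nbrs E' v \<inter> X \<inter> B)"
      using eq[OF X] by (simp add: Int_assoc)
  qed fact
  have V: "nbrs E v \<inter> V = nbrs E v" "nbrs E' v \<inter> V = nbrs E' v"
    using nbrs_subset[OF G(1), of v] nbrs_subset[OF G(2), of v] by auto
  show "card (nbrs E v) = card (nbrs E' v)" using eq[OF _ Bs_V, of V] by (simp add: V)
  show "nbrs E v = nbrs E' v" if "card (nbrs E v) \<le> s" using rec[of V] that by (simp add: V)
  show "nbrs E v \<inter> level (fst r) j = nbrs E' v \<inter> level (fst r) j"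
    if "j < L" "card (nbrs E v \<inter> level (fst r) j) \<le> s"
    using rec[of "level (fst r) j"] that by simp
qed

lemma lv_bounds:
  assumes "graph_on V E" "high E v"
  shows "lv E v \<in> levels" "2 ^ lv E v \<le> card (nbrs E v)" "card (nbrs E v) < 2 ^ Suc (lv E v)"
proof -
  show 1: "2 ^ lv E v \<le> card (nbrs E v)"
    using assms(2) unfolding lv_def by (intro floor_log_exp2_le) (simp add: high_def)
  show 2: "card (nbrs E v) < 2 ^ Suc (lv E v)" by (simp add: lv_def floor_log_exp2_gt)
  have "card (nbrs E v) \<le> card V" using card_mono[OF finite_V nbrs_subset[OF assms(1)]] .
  then have "(2::nat) ^ lv E v < 2 ^ L" using 1 card_V_less by linarith
  then have "lv E v < L" by simp
  then show "lv E v \<in> levels" using 2 assms(2) by (simp add: levels_def high_def)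
qed

lemma hits_subset_centers: "graph_on V E \<Longrightarrow> high E v \<Longrightarrow> hits R E v \<subseteq> centers R"
  using lv_bounds(1) by (auto simp: hits_def centers_def)

lemma agree_sym: "agree Qs E E' \<Longrightarrow> agree Qs E' E"
  by (simp add: agree_def)

lemma agree_high_lv:
  assumes "graph_on V E" "graph_on V E'" "agree (queries1 r) E E'" "v \<in> V"
  shows "high E v \<longleftrightarrow> high E' v" "lv E v = lv E' v"
  using agree_nbrs(1)[OF assms] by (simp_all add: high_def lv_def)

lemma agree_hits:
  assumes "graph_on V E" "graph_on V E'" "agree (queries1 r) E E'" "v \<in> V"
    "high E v" "card (hits (fst r) E v) \<le> s"
  shows "hits (fst r) E v = hits (fst r) E' v"
  using agree_nbrs(3)[OF assms(1-4), of "lv E v"] lv_bounds(1)[OF assms(1,5)] assms(6)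
  by (simp add: hits_def levels_def agree_high_lv[OF assms(1-4)])

lemma agree_ok:
  assumes "graph_on V E" "graph_on V E'" "agree (queries1 r) E E'" "ok r E"
  shows "ok r E'"
  using assms(4) agree_hits[OF assms(1-3)] agree_high_lv[OF assms(1-3)] unfolding ok_def by metis

lemma agree_rep:
  assumes "graph_on V E" "graph_on V E'" "agree (queries1 r) E E'" "ok r E" "v \<in> V"
  shows "rep r E v = rep r E' v"
  using assms(4,5) agree_hits[OF assms(1-3,5)] agree_high_lv[OF assms(1-3,5)]
  by (simp add: rep_def ok_def)

lemma agree_queries2_candidates:
  assumes "graph_on V E" "graph_on V E'" "agree (queries1 r) E E'"
  shows "queries2 r E = queries2 r E'" "candidates r E = candidates r E'"
proof -
  have o: "ok r E \<longleftrightarrow> ok r E'" using agree_ok assms agree_sym by metis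
  have "fiber r E = fiber r E'" if "ok r E"
    using agree_rep[OF assms that] by (auto simp: fiber_def fun_eq_iff)
  then show "queries2 r E = queries2 r E'" by (simp add: queries2_def o)
  show "candidates r E = candidates r E'"
    using agree_rep[OF assms] by (simp add: candidates_def o)
qed

lemma cut_singleton_agree:
  assumes "graph_on V E" "graph_on V E'" "agree (queries1 r) E E'" "v \<in> V"
  shows "cut E {v} = cut E' {v}"
  using agree_nbrs(1)[OF assms] assms(4) by (simp add: cut_singleton[OF assms(1)] cut_singleton[OF assms(2)])

text \<open>Two graphs with the same answers differ only on pairs of high-degree vertices, and the
  second round fixes the number of edges between any two fibers.\<close>

lemma cut_saturated_agree:
  assumes G: "graph_on V E" "graph_on V E'" and ag: "agree (queries1 r) E E'" "agree (queries2 r E) E E'"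
    and ok: "ok r E" and S: "S \<subseteq> V" "\<And>v. v \<in> V \<Longrightarrow> v \<in> S \<longleftrightarrow> rep r E v \<in> S"
  shows "cut E S = cut E' S"
proof -
  define C where "C = centers (fst r)"
  define F where "F = fiber r E"
  \<comment> \<open>\<open>h\<close> is the disagreement of the two graphs; the goal is that it sums
    to zero across the cut.\<close>
  define h where "h x y = adj E x y - adj E' x y" for x y
  have fin: "finite C" "finite S" "finite (V - S)"
    using finite_centers finite_V finite_subset[OF S(1)] by (auto simp: C_def)
  have F_sub: "F a \<subseteq> V" for a by (auto simp: F_def fiber_def)
  have low: "h x y = 0" if "x \<in> V" "\<not> high E x" for x y
    using agree_nbrs(2)[OF G ag(1) that(1)] that(2) by (simp add: h_def adj_nbrs high_def)
  have h_commute: "h x y = h y x" for x y by (simp add: h_def adj_commute)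
  have rep_C: "rep r E x \<in> C" if "x \<in> V" "high E x" for x
    using that ok hits_subset_centers[OF G(1) that(2)] by (auto simp: rep_def ok_def C_def)
  have F_pair: "(\<Sum>x\<in>F a. \<Sum>y\<in>F b. h x y) = 0" if "a \<in> C" "b \<in> C" "a \<noteq> b" for a b
  proof -
    have q: "F c \<union> F d \<in> set (queries2 r E)" if "c \<in> C" "d \<in> C" for c d
      using that ok fin(1) by (auto simp: queries2_def F_def C_def)
    have "cut E (F c \<union> F d) = cut E' (F c \<union> F d)" if "c \<in> C" "d \<in> C" for c d
      using ag(2) q[OF that] by (simp add: agree_iff)
    from this[OF that(1,1)] this[OF that(2,2)] this[OF that(1,2)]
    have "cut E (F a) = cut E' (F a)" "cut E (F b) = cut E' (F b)"
      "cut E (F a \<union> F b) = cut E' (F a \<union> F b)" by simp_all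
    moreover have "F a \<inter> F b = {}" using that(3) by (auto simp: F_def fiber_def)
    ultimately show ?thesis
      using sum_adj_disjoint_cut[OF G(1) F_sub[of a] F_sub[of b]]
        sum_adj_disjoint_cut[OF G(2) F_sub[of a] F_sub[of b]]
      by (simp add: h_def sum_subtractf)
  qed
  \<comment> \<open>Used once for each side of the cut: a vertex outside all fibers of centres has
    low degree, where \<open>g\<close> vanishes, so a saturated sum splits into whole fibers of
    centres.\<close>
  have part: "(\<Sum>x\<in>X. g x) = (\<Sum>a\<in>C \<inter> X. \<Sum>x\<in>F a. g x)"
    if X: "X \<subseteq> V" "\<And>v. v \<in> V \<Longrightarrow> v \<in> X \<longleftrightarrow> rep r E v \<in> X"
      and g: "\<And>x. x \<in> V \<Longrightarrow> \<not> high E x \<Longrightarrow> g x = 0" for X and g :: "nat \<Rightarrow> real"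
  proof -
    let ?Y = "{x \<in> X. rep r E x \<in> C}"
    have fX: "finite X" using finite_subset[OF X(1) finite_V] .
    have "(\<Sum>x\<in>X. g x) = (\<Sum>x\<in>?Y. g x)"
      using X(1) g rep_C fX by (intro sum.mono_neutral_right) auto
    also have "\<dots> = (\<Sum>a\<in>C \<inter> X. \<Sum>x\<in>{x \<in> ?Y. rep r E x = a}. g x)"
      using X fX fin(1) by (intro sum.group[symmetric]) auto
    also have "\<dots> = (\<Sum>a\<in>C \<inter> X. \<Sum>x\<in>F a. g x)"
      using X by (intro sum.cong refl) (auto simp: F_def fiber_def)
    finally show ?thesis .
  qed
  have other_side: "(\<Sum>y\<in>V - S. h x y) = (\<Sum>b\<in>C \<inter> (V - S). \<Sum>y\<in>F b. h x y)" for x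
  proof (rule part)
    show "v \<in> V - S \<longleftrightarrow> rep r E v \<in> V - S" if "v \<in> V" for v
    proof -
      have "rep r E v \<in> V"
      proof (cases "high E v")
        case True
        then show ?thesis using rep_C[OF that] centers_subset by (auto simp: C_def)
      qed (simp add: rep_def that)
      then show ?thesis using S(2)[OF that] that by blast
    qed
    show "h x y = 0" if "y \<in> V" "\<not> high E y" for y
      using low[OF that] by (simp only: h_commute[of x y])
  qed simp
  have "cut E S - cut E' S = (\<Sum>x\<in>S. \<Sum>y\<in>V - S. h x y)"
    by (simp add: cut_eq_sum_adj[OF G(1) S(1)] cut_eq_sum_adj[OF G(2) S(1)] h_def sum_subtractf)
  also have "\<dots> = (\<Sum>a\<in>C \<inter> S. \<Sum>x\<in>F a. \<Sum>y\<in>V - S. h x y)"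
    by (rule part) (use S low in auto)
  also have "\<dots> = (\<Sum>a\<in>C \<inter> S. \<Sum>x\<in>F a. \<Sum>b\<in>C \<inter> (V - S). \<Sum>y\<in>F b. h x y)"
    by (simp only: other_side)
  also have "\<dots> = (\<Sum>a\<in>C \<inter> S. \<Sum>b\<in>C \<inter> (V - S). \<Sum>x\<in>F a. \<Sum>y\<in>F b. h x y)"
    by (intro sum.cong refl sum.swap)
  also have "\<dots> = 0"
    by (intro sum.neutral ballI F_pair) auto
  finally show ?thesis by simp
qed

lemma cut_candidates_agree:
  assumes "graph_on V E" "graph_on V E'" "agree (queries1 r) E E'" "agree (queries2 r E) E E'"
    "S \<in> candidates r E"
  shows "cut E S = cut E' S"
proof (cases "\<exists>v\<in>V. S = {v}")
  case True
  then show ?thesis using cut_singleton_agree[OF assms(1-3)] by auto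
next
  case False
  then have "ok r E" "S \<subset> V" "\<forall>v\<in>V. v \<in> S \<longleftrightarrow> rep r E v \<in> S"
    using assms(5) by (auto simp: candidates_def split: if_splits)
  then show ?thesis using cut_saturated_agree[OF assms(1-4)] by blast
qed

end

section \<open>Minimum cuts and random centres\<close>

definition same_side :: "'v set set \<Rightarrow> 'v set \<Rightarrow> 'v \<Rightarrow> 'v set" where
  "same_side E S v = {u \<in> nbrs E v. u \<in> S \<longleftrightarrow> v \<in> S}"

definition crossing :: "'v set set \<Rightarrow> 'v set \<Rightarrow> 'v \<Rightarrow> 'v set" where
  "crossing E S v = {u \<in> nbrs E v. (u \<in> S) \<noteq> (v \<in> S)}"

lemma nbrs_split:
  "nbrs E v = same_side E S v \<union> crossing E S v" "same_side E S v \<inter> crossing E S v = {}"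
  by (auto simp: same_side_def crossing_def)

lemma card_nbrs_split:
  assumes "graph_on V E"
  shows "card (nbrs E v) = card (same_side E S v) + card (crossing E S v)"
proof -
  have "finite (same_side E S v \<union> crossing E S v)"
    using finite_nbrs[OF assms, of v] by (simp flip: nbrs_split(1))
  then show ?thesis
    using nbrs_split(2)[of E S v] by (simp add: nbrs_split(1)[of E v S] card_Un_disjoint)
qed

lemma cut_compl:
  assumes "graph_on V E" "S \<subseteq> V"
  shows "cut E (V - S) = cut E S"
proof -
  have "V - (V - S) = S" using assms(2) by auto
  then have "cut E (V - S) = (\<Sum>x\<in>V - S. \<Sum>y\<in>S. adj E x y)"
    using cut_eq_sum_adj[OF assms(1), of "V - S"] by simp
  also have "\<dots> = (\<Sum>y\<in>S. \<Sum>x\<in>V - S. adj E y x)"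
    by (subst sum.swap) (simp only: adj_commute)
  finally show ?thesis using cut_eq_sum_adj[OF assms] by simp
qed

lemma cut_eq_sum_crossing:
  assumes G: "graph_on V E" and S: "S \<subseteq> V"
  shows "cut E S = (\<Sum>v\<in>S. real (card (crossing E S v)))"
proof -
  have "nbrs E v \<inter> (V - S) = crossing E S v" if "v \<in> S" for v
    using nbrs_subset[OF G, of v] that by (auto simp: crossing_def)
  moreover have "finite (V - S)" using graph_onD(1)[OF G] by simp
  ultimately show ?thesis by (simp add: cut_eq_sum_adj[OF G S] sum_adj)
qed

lemma sum_crossing:
  assumes G: "graph_on V E" and S: "S \<subseteq> V"
  shows "(\<Sum>v\<in>V. real (card (crossing E S v))) = 2 * cut E S"
proof -
  have "crossing E (V - S) v = crossing E S v" if "v \<in> V" for v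
    using nbrs_subset[OF G, of v] that by (auto simp: crossing_def)
  then have "cut E (V - S) = (\<Sum>v\<in>V - S. real (card (crossing E S v)))"
    using cut_eq_sum_crossing[OF G, of "V - S"] by simp
  moreover have "(\<Sum>v\<in>V. real (card (crossing E S v))) =
      (\<Sum>v\<in>V - S. real (card (crossing E S v))) + (\<Sum>v\<in>S. real (card (crossing E S v)))"
    by (rule sum.subset_diff[OF S graph_onD(1)[OF G]])
  ultimately show ?thesis using cut_eq_sum_crossing[OF G S] cut_compl[OF G S] by simp
qed

lemma min_cut_le_degree:
  assumes "graph_on V E" "2 \<le> card V" "is_min_cut V E unit_weight S" "v \<in> V"
  shows "cut E S \<le> card (nbrs E v)"
proof -
  have "{v} \<subset> V" using assms(2,4) by (auto simp: psubset_eq)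
  then have "cut E S \<le> cut E {v}" using assms(3) by (auto simp: is_min_cut_def)
  then show ?thesis using cut_singleton[OF assms(1,4)] by simp
qed

text \<open>Excluding singleton minimum cuts ensures that the cut stays proper after
  \<open>v\<close> has moved: if \<open>v\<close> were alone on its side, \<open>{v}\<close> would
  itself be a minimum cut, directly or via the complement.\<close>

lemma crossing_le_same_side:
  assumes G: "graph_on V E" and S: "is_min_cut V E unit_weight S"
    and no_singleton: "\<And>u. u \<in> V \<Longrightarrow> \<not> is_min_cut V E unit_weight {u}" and v: "v \<in> V"
  shows "card (crossing E S v) \<le> card (same_side E S v)"
proof -
  have SV: "S \<noteq> {}" "S \<subset> V" "S \<subseteq> V" and min: "\<And>T. T \<noteq> {} \<Longrightarrow> T \<subset> V \<Longrightarrow> cut E S \<le> cut E T"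
    using S by (auto simp: is_min_cut_def)
  have fin: "finite S" using finite_subset[OF SV(3) graph_onD(1)[OF G]] .
  have d: "cut E {v} = real (card (same_side E S v)) + card (crossing E S v)"
    using cut_singleton[OF G v] card_nbrs_split[OF G, of v S] by simp
  show ?thesis
  proof (cases "v \<in> S")
    case True
    have "S \<noteq> {v}" using no_singleton[OF v] S by auto
    then have "S - {v} \<noteq> {}" using True by auto
    moreover have "S - {v} \<subset> V" using SV by auto
    ultimately have le: "cut E S \<le> cut E (S - {v})" by (rule min)
    have "nbrs E v \<inter> (S - {v}) = same_side E S v"
      using True nbrs_irrefl[OF G, of v] by (auto simp: same_side_def)
    moreover have "insert v (S - {v}) = S" using True by auto
    ultimately have "2 * real (card (same_side E S v)) = cut E {v} + cut E (S - {v}) - cut E S"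
      using card_nbrs_Int_cut[OF G v SV(3)] card_nbrs_Int_cut[OF G v, of "S - {v}"] SV(3) by auto
    then show ?thesis using le d by simp
  next
    case False
    have "insert v S \<noteq> V"
    proof
      assume "insert v S = V"
      then have "V - S = {v}" using False by auto
      then have "cut E {v} = cut E S" using cut_compl[OF G SV(3)] by simp
      then have "is_min_cut V E unit_weight {v}"
        using S \<open>V - S = {v}\<close> SV by (auto simp: is_min_cut_def)
      then show False using no_singleton[OF v] by simp
    qed
    then have "insert v S \<subset> V" using SV v by auto
    then have le: "cut E S \<le> cut E (insert v S)" by (intro min) auto
    have "nbrs E v \<inter> S = crossing E S v" "S - {v} = S" using False by (auto simp: crossing_def)
    then have "2 * real (card (crossing E S v)) = cut E {v} + cut E S - cut E (insert v S)"
      using card_nbrs_Int_cut[OF G v SV(3)] by simp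
    then show ?thesis using le d by simp
  qed
qed

lemma exists_min_cut:
  assumes "finite V" "2 \<le> card V"
  shows "\<exists>S. is_min_cut V E w S"
proof -
  let ?F = "{S. S \<noteq> {} \<and> S \<subset> V}"
  obtain v where v: "v \<in> V" using assms(2) by fastforce
  then have "{v} \<in> ?F" using assms(2) by (auto simp: psubset_eq)
  moreover have "finite ?F" by (rule finite_subset[of _ "Pow V"]) (use assms in auto)
  ultimately have "is_min_cut V E w (arg_min_on (cut_value E w) ?F)"
    using arg_min_if_finite[of ?F "cut_value E w"] by (auto simp: is_min_cut_def not_less)
  then show ?thesis by blast
qed

section \<open>Moments and tail estimates for independent bits\<close>

text \<open>The moment generating function of a binomial count, with base \<open>\<theta>\<close> in
  place of an exponential. The values 1/2 and 2 give the lower and upper Chernoff bounds;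
  coordinates outside \<open>M\<close> contribute a factor 1.\<close>

lemma expectation_power_card_Pi_bernoulli:
  fixes \<theta> q :: real
  assumes I: "finite I" and M: "M \<subseteq> I" and p: "\<And>i. i \<in> M \<Longrightarrow> p i = bernoulli_pmf q"
    and q: "0 \<le> q" "q \<le> 1" and \<theta>: "0 \<le> \<theta>"
  shows "measure_pmf.expectation (Pi_pmf I False p) (\<lambda>f. \<theta> ^ card {i \<in> M. f i}) = (1 - q + q * \<theta>) ^ card M"
proof -
  define g where "g i b = (if i \<in> M \<and> b then \<theta> else 1)" for i and b :: bool
  have "\<theta> ^ card {i \<in> M. f i} = (\<Prod>i\<in>I. g i (f i))" for f
  proof -
    have "(\<Prod>i\<in>I. g i (f i)) = (\<Prod>i\<in>M. g i (f i))"
      using I M by (intro prod.mono_neutral_right) (auto simp: g_def)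
    also have "\<dots> = (\<Prod>i\<in>{i \<in> M. f i}. g i (f i))"
      using finite_subset[OF M I] by (intro prod.mono_neutral_right) (auto simp: g_def)
    also have "\<dots> = (\<Prod>i\<in>{i \<in> M. f i}. \<theta>)" by (intro prod.cong) (auto simp: g_def)
    finally show ?thesis by simp
  qed
  then have "measure_pmf.expectation (Pi_pmf I False p) (\<lambda>f. \<theta> ^ card {i \<in> M. f i}) =
      measure_pmf.expectation (Pi_pmf I False p) (\<lambda>f. \<Prod>i\<in>I. g i (f i))"
    by simp
  also have "\<dots> = (\<Prod>i\<in>I. measure_pmf.expectation (p i) (g i))"
    using I \<theta> by (intro expectation_prod_Pi_pmf integrable_measure_pmf_finite) (auto simp: g_def)
  also have "\<dots> = (\<Prod>i\<in>M. measure_pmf.expectation (p i) (g i))"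
  proof (rule prod.mono_neutral_right[OF I M])
    have "g i = (\<lambda>_. 1)" if "i \<notin> M" for i using that by (simp add: g_def fun_eq_iff)
    then show "\<forall>i\<in>I - M. measure_pmf.expectation (p i) (g i) = 1" by simp
  qed
  also have "\<dots> = (\<Prod>i\<in>M. 1 - q + q * \<theta>)"
    using q by (intro prod.cong refl) (simp add: p g_def algebra_simps)
  finally show ?thesis by simp
qed

lemma finite_set_Pi_pmf:
  assumes "finite I" "\<And>i. i \<in> I \<Longrightarrow> finite (set_pmf (p i))"
  shows "finite (set_pmf (Pi_pmf I d p))"
  using assms by (intro finite_subset[OF set_Pi_pmf_subset' finite_PiE_dflt]) auto

text \<open>Markov's inequality with \<open>g\<close> already scaled to be at least 1 on the event;
  all tail bounds below go through it.\<close>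

lemma prob_le_expectation:
  assumes "integrable (measure_pmf P) g" "\<And>x. 0 \<le> g x" "\<And>x. x \<in> A \<Longrightarrow> 1 \<le> (g x :: real)"
  shows "measure_pmf.prob P A \<le> measure_pmf.expectation P g"
proof -
  have "measure_pmf.prob P A = measure_pmf.expectation P (indicator A)" by simp
  also have "\<dots> \<le> measure_pmf.expectation P g"
    using assms
    by (intro integral_mono integrable_real_indicator) (auto simp: indicator_def less_top[symmetric])
  finally show ?thesis .
qed

lemma expectation_card_Pi_bernoulli:
  fixes q :: real
  assumes I: "finite I" and M: "M \<subseteq> I" and p: "\<And>i. i \<in> M \<Longrightarrow> p i = bernoulli_pmf q"
    and q: "0 \<le> q" "q \<le> 1" and fin: "finite (set_pmf (Pi_pmf I False p))"
  shows "measure_pmf.expectation (Pi_pmf I False p) (\<lambda>f. real (card {i \<in> M. f i})) = q * card M"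
proof -
  have "measure_pmf.expectation (Pi_pmf I False p) (\<lambda>f. real (card {i \<in> M. f i})) =
      measure_pmf.expectation (Pi_pmf I False p) (\<lambda>f. \<Sum>i\<in>M. of_bool (f i))"
    using finite_subset[OF M I] by (simp add: Collect_conj_eq)
  also have "\<dots> = (\<Sum>i\<in>M. measure_pmf.expectation (Pi_pmf I False p) (\<lambda>f. of_bool (f i)))"
    using fin by (intro Bochner_Integration.integral_sum integrable_measure_pmf_finite)
  also have "\<dots> = (\<Sum>i\<in>M. q)"
  proof (rule sum.cong[OF refl])
    fix i assume i: "i \<in> M"
    have "measure_pmf.expectation (Pi_pmf I False p) (\<lambda>f. of_bool (f i) :: real) =
        measure_pmf.expectation (map_pmf (\<lambda>f. f i) (Pi_pmf I False p)) of_bool"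
      by simp
    also have "map_pmf (\<lambda>f. f i) (Pi_pmf I False p) = bernoulli_pmf q"
      using i M p[OF i] by (simp add: Pi_pmf_component[OF I] subset_iff)
    finally show "measure_pmf.expectation (Pi_pmf I False p) (\<lambda>f. of_bool (f i)) = q"
      using q by simp
  qed
  finally show ?thesis by (simp add: mult.commute)
qed

text \<open>Invert \<open>1 + x \<le> exp x\<close> at \<open>x = c / g\<close>. Passing from
  \<open>g\<close> to its lower bound \<open>b\<close> gives all exponents a common denominator, so
  that a product of such ratios is controlled by the sum of the \<open>c\<close> alone.\<close>

lemma ratio_ge_exp:
  fixes g c b :: real
  assumes "0 < b" "b \<le> g" "0 \<le> c"
  shows "exp (- (c / b)) \<le> g / (g + c)"
proof -
  have "c / g \<le> c / b" using assms by (intro divide_left_mono) auto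
  moreover have "1 + c / g \<le> exp (c / g)" by (rule exp_ge_add_one_self)
  moreover have "exp (c / g) \<le> exp (c / b)" using \<open>c / g \<le> c / b\<close> by simp
  ultimately have le: "1 + c / g \<le> exp (c / b)" by linarith
  have pos: "0 < 1 + c / g" using assms by (intro add_pos_nonneg) auto
  have "exp (- (c / b)) = inverse (exp (c / b))" by (rule exp_minus)
  also have "\<dots> \<le> inverse (1 + c / g)" by (rule le_imp_inverse_le[OF le pos])
  also have "\<dots> = g / (g + c)" using assms by (simp add: field_simps)
  finally show ?thesis .
qed

text \<open>The power is at most \<open>exp (- 2) ^ b\<close>, and \<open>exp 2 \<ge> 4\<close>
  outweighs the factor \<open>2 ^ b\<close> twice over.\<close>

lemma lower_tail_numeric:
  fixes q :: real
  assumes "0 \<le> q" "q \<le> 1" "4 * real b \<le> q * real k"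
  shows "2 ^ b * (1 - q / 2) ^ k \<le> (1 / 2) ^ b"
proof -
  have "(1 - q / 2) ^ k \<le> exp (- (q / 2)) ^ k"
    using assms exp_ge_add_one_self[of "- (q / 2)"] by (intro power_mono) auto
  also have "\<dots> = exp (- (q * k / 2))" by (simp flip: exp_of_nat_mult add: mult_ac)
  also have "\<dots> \<le> exp (- (2 * real b))" using assms(3) by simp
  also have "\<dots> = exp (- 2) ^ b" by (simp flip: exp_of_nat_mult add: mult_ac)
  also have "\<dots> \<le> (1 / 4) ^ b"
  proof (rule power_mono)
    have "(2::real) * 2 \<le> exp 1 * exp 1"
      using exp_ge_add_one_self[of "1::real"] by (intro mult_mono) auto
    then have "4 \<le> exp (2::real)" by (simp flip: exp_add)
    then show "exp (- 2) \<le> (1 / 4 :: real)" by (simp add: exp_minus field_simps)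
  qed simp
  finally have "2 ^ b * (1 - q / 2) ^ k \<le> 2 ^ b * (1 / 4) ^ b" by simp
  also have "\<dots> = (1 / 2 :: real) ^ b" by (simp flip: power_mult_distrib)
  finally show ?thesis .
qed

text \<open>Origin of the 32: it gives \<open>2 ^ s \<ge> 4 ^ (16 * b)\<close>, against a numerator
  of at most \<open>exp 1 ^ (16 * b) \<le> 3 ^ (16 * b)\<close>.\<close>

lemma upper_tail_numeric:
  fixes q :: real
  assumes "0 \<le> q" "q * real k \<le> 16 * real b" "32 * b \<le> s"
  shows "(1 + q) ^ k / 2 ^ s \<le> (1 / 2) ^ b"
proof -
  have "(1 + q) ^ k \<le> exp q ^ k"
    using assms exp_ge_add_one_self[of q] by (intro power_mono) auto
  also have "\<dots> = exp (q * k)" by (simp flip: exp_of_nat_mult add: mult_ac)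
  also have "\<dots> \<le> exp (real (16 * b) * 1)" using assms(2) by simp
  also have "\<dots> = exp 1 ^ (16 * b)" by (rule exp_of_nat_mult)
  also have "\<dots> \<le> 3 ^ (16 * b)" by (intro power_mono exp_le) simp
  finally have 1: "(1 + q) ^ k \<le> 3 ^ (16 * b)" .
  have "(4::real) ^ (16 * b) = (2 ^ 2) ^ (16 * b)" by simp
  also have "\<dots> = 2 ^ (32 * b)" by (subst power_mult[symmetric]) simp
  also have "\<dots> \<le> 2 ^ s" by (rule power_increasing[OF assms(3)]) simp
  finally have 2: "(4::real) ^ (16 * b) \<le> 2 ^ s" .
  have "(1 + q) ^ k / 2 ^ s \<le> 3 ^ (16 * b) / 4 ^ (16 * b)"
    using 1 2 by (intro frac_le) auto
  also have "\<dots> = ((3 / 4) ^ 16) ^ b" by (simp add: power_divide power_mult)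
  also have "\<dots> \<le> (1 / 2 :: real) ^ b" by (intro power_mono) (simp_all add: power_divide)
  finally show ?thesis .
qed

section \<open>The random trial and its concentration bounds\<close>

text \<open>\<open>b\<close> is the number of own-side centres guaranteed to each high vertex. Tail
  probabilities \<open>2 ^ -b\<close>, summed over \<open>V\<close>, must stay below 1/8. The last
  assumption is eight times the bound \<open>16 * L * card V * b / s\<close> on the expected number
  of centres.\<close>

locale star_trials = star_contraction +
  fixes b :: nat
  assumes b_ge: "8 * card V \<le> 2 ^ b" and s_ge: "32 * b \<le> s"
    and m_ge: "128 * L * card V * b \<le> m * s"
begin

text \<open>The factor 8 provides at least \<open>4 * b\<close> expected centres among
  \<open>2 ^ j / 2\<close> vertices, the least number of own-side neighbours at level
  \<open>j\<close>.\<close>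

definition rate :: "nat \<Rightarrow> real" where
  "rate j = min 1 (8 * real b / 2 ^ j)"

definition centers_pmf :: "(nat \<times> nat \<Rightarrow> bool) pmf" where
  "centers_pmf = Pi_pmf ({..<L} \<times> V) False (\<lambda>i. bernoulli_pmf (rate (fst i)))"

text \<open>All randomness is drawn before any answer is seen, so an independent uniform choice is
  prepared for every vertex and every nonempty set of hits it might turn out to have.\<close>

definition choice_pmf :: "(nat \<times> nat set \<Rightarrow> nat) pmf" where
  "choice_pmf = Pi_pmf (V \<times> (Pow V - {{}})) 0 (\<lambda>i. pmf_of_set (snd i))"

definition trial_pmf :: "trial pmf" where
  "trial_pmf = bind_pmf centers_pmf (\<lambda>R. map_pmf (Pair R) choice_pmf)"

lemma b_pos: "0 < b"
  using b_ge card_V_ge by (cases b) auto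

lemma L_pos: "0 < L"
  using card_V_less card_V_ge by (cases L) auto

lemma s_pos: "0 < s"
  using b_pos s_ge by linarith

lemma m_pos: "0 < m"
proof -
  have "0 < 128 * L * card V * b" using b_pos L_pos card_V_ge by simp
  then have "0 < m * s" using m_ge by linarith
  then show ?thesis by simp
qed

lemma rate_bounds: "0 \<le> rate j" "rate j \<le> 1"
  by (auto simp: rate_def)

lemma rate_level:
  assumes "j \<in> levels"
  shows "rate j = 8 * real b / 2 ^ j" "rate j \<le> 16 * real b / real s"
proof -
  have 1: "s < 2 ^ Suc j" using assms by (simp add: levels_def)
  then have "8 * b \<le> 2 ^ j" using s_ge by simp
  then have "8 * real b \<le> 2 ^ j" by (metis of_nat_le_iff of_nat_mult of_nat_numeral of_nat_power)
  then show eq: "rate j = 8 * real b / 2 ^ j" by (simp add: rate_def min_def)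
  have "real s < 2 * 2 ^ j" using 1 by (metis of_nat_less_iff of_nat_numeral of_nat_power power_Suc)
  then have "8 * real b / 2 ^ j \<le> 8 * real b / (real s / 2)"
    using s_pos by (intro divide_left_mono) auto
  then show "rate j \<le> 16 * real b / real s" by (simp add: eq)
qed

lemma finite_centers_pmf: "finite (set_pmf centers_pmf)"
  unfolding centers_pmf_def using finite_V
  by (intro finite_set_Pi_pmf) (auto intro: finite_subset[OF subset_UNIV])

lemma integrable_centers [simp]: "integrable (measure_pmf centers_pmf) (f :: _ \<Rightarrow> real)"
  by (rule integrable_measure_pmf_finite[OF finite_centers_pmf])

lemma card_Int_level: "M \<subseteq> V \<Longrightarrow> card (M \<inter> level R j) = card {i \<in> {j} \<times> M. R i}"
  by (rule bij_betw_same_card[of "Pair j"]) (auto simp: bij_betw_def inj_on_def level_def)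

lemma expectation_power_level:
  assumes "j \<in> levels" "M \<subseteq> V" "0 \<le> \<theta>"
  shows "measure_pmf.expectation centers_pmf (\<lambda>R. \<theta> ^ card (M \<inter> level R j)) =
    (1 - rate j + rate j * \<theta>) ^ card M"
proof -
  have "{j} \<times> M \<subseteq> {..<L} \<times> V" using assms by (auto simp: levels_def)
  then show ?thesis
    unfolding centers_pmf_def card_Int_level[OF assms(2)] using assms(3) rate_bounds[of j] finite_V
    by (subst expectation_power_card_Pi_bernoulli[where q = "rate j"]) (auto simp: card_cartesian_product_singleton)
qed

lemma expectation_card_level:
  assumes "j \<in> levels" "M \<subseteq> V"
  shows "measure_pmf.expectation centers_pmf (\<lambda>R. real (card (M \<inter> level R j))) = rate j * card M"
proof -
  have "{j} \<times> M \<subseteq> {..<L} \<times> V" using assms by (auto simp: levels_def)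
  then show ?thesis
    unfolding centers_pmf_def card_Int_level[OF assms(2)] using rate_bounds[of j] finite_V
      finite_centers_pmf[unfolded centers_pmf_def]
    by (subst expectation_card_Pi_bernoulli[where q = "rate j"]) (auto simp: card_cartesian_product_singleton)
qed

text \<open>Chernoff with base 1/2, where the mean is at least \<open>4 * b\<close>. It is applied
  to the own-side neighbours of a high vertex.\<close>

lemma few_hits:
  assumes j: "j \<in> levels" and M: "M \<subseteq> V" "2 ^ j \<le> 2 * card M"
  shows "measure_pmf.prob centers_pmf {R. card (M \<inter> level R j) < b} \<le> (1 / 2) ^ b"
proof -
  have M2: "2 ^ j \<le> 2 * real (card M)" using M(2) by (metis of_nat_le_iff of_nat_mult of_nat_numeral of_nat_power)
  have "measure_pmf.prob centers_pmf {R. card (M \<inter> level R j) < b} \<le>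
      measure_pmf.expectation centers_pmf (\<lambda>R. 2 ^ b * (1 / 2) ^ card (M \<inter> level R j))"
  proof (rule prob_le_expectation)
    fix R assume "R \<in> {R. card (M \<inter> level R j) < b}"
    then have "(2::real) ^ card (M \<inter> level R j) \<le> 2 ^ b" by (intro power_increasing) auto
    then show "1 \<le> 2 ^ b * (1 / 2 :: real) ^ card (M \<inter> level R j)" by (simp add: power_one_over field_simps)
  qed simp_all
  also have "\<dots> = 2 ^ b * (1 - rate j / 2) ^ card M"
    using expectation_power_level[OF j M(1), of "1 / 2"] by (simp add: algebra_simps)
  also have "\<dots> \<le> (1 / 2) ^ b"
  proof (rule lower_tail_numeric)
    have "8 * real b * 2 ^ j \<le> 8 * real b * (2 * real (card M))"
      using M2 by (intro mult_left_mono) auto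
    then show "4 * real b \<le> rate j * real (card M)" by (simp add: rate_level(1)[OF j] field_simps)
  qed (rule rate_bounds)+
  finally show ?thesis .
qed

text \<open>Chernoff with base 2, where the mean is at most \<open>16 * b\<close>. It is applied to
  whole neighbourhoods, so that the hits are sparse enough to be recovered.\<close>

lemma many_hits:
  assumes j: "j \<in> levels" and M: "M \<subseteq> V" "card M \<le> 2 * 2 ^ j"
  shows "measure_pmf.prob centers_pmf {R. s < card (M \<inter> level R j)} \<le> (1 / 2) ^ b"
proof -
  have M2: "real (card M) \<le> 2 * 2 ^ j" using M(2) by (metis of_nat_le_iff of_nat_mult of_nat_numeral of_nat_power)
  have "measure_pmf.prob centers_pmf {R. s < card (M \<inter> level R j)} \<le>
      measure_pmf.expectation centers_pmf (\<lambda>R. 2 ^ card (M \<inter> level R j) / 2 ^ s)"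
  proof (rule prob_le_expectation)
    fix R assume "R \<in> {R. s < card (M \<inter> level R j)}"
    then have "(2::real) ^ s \<le> 2 ^ card (M \<inter> level R j)" by (intro power_increasing) auto
    then show "1 \<le> (2::real) ^ card (M \<inter> level R j) / 2 ^ s" by simp
  qed simp_all
  also have "\<dots> = (1 + rate j) ^ card M / 2 ^ s"
    using expectation_power_level[OF j M(1), of 2] by (simp add: algebra_simps)
  also have "\<dots> \<le> (1 / 2) ^ b"
  proof (rule upper_tail_numeric[OF rate_bounds(1) _ s_ge])
    have "8 * real b * real (card M) \<le> 8 * real b * (2 * 2 ^ j)"
      using M2 by (intro mult_left_mono) auto
    then show "rate j * real (card M) \<le> 16 * real b" by (simp add: rate_level(1)[OF j] field_simps)
  qed
  finally show ?thesis .
qed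

lemma many_centers:
  "measure_pmf.prob centers_pmf {R. m < card (centers R)} \<le> 1 / 8"
proof -
  have fin: "finite levels" "card levels \<le> L"
    using card_mono[of "{..<L}" levels] finite_subset[of levels "{..<L}"] by (auto simp: levels_def)
  have "measure_pmf.prob centers_pmf {R. m < card (centers R)} \<le>
      measure_pmf.expectation centers_pmf (\<lambda>R. (\<Sum>j\<in>levels. real (card (V \<inter> level R j))) / real m)"
  proof (rule prob_le_expectation)
    fix R assume "R \<in> {R. m < card (centers R)}"
    then have "m < card (centers R)" by simp
    also have "card (centers R) \<le> (\<Sum>j\<in>levels. card (level R j))"
      unfolding centers_def by (rule card_UN_le[OF fin(1)])
    finally have "m \<le> (\<Sum>j\<in>levels. card (V \<inter> level R j))"
      using level_subset[of R] by (simp add: Int_absorb1)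
    then have "real m \<le> (\<Sum>j\<in>levels. real (card (V \<inter> level R j)))"
      by (metis of_nat_le_iff of_nat_sum)
    then show "1 \<le> (\<Sum>j\<in>levels. real (card (V \<inter> level R j))) / real m"
      using m_pos by simp
  qed (simp_all add: sum_nonneg)
  also have "\<dots> = (\<Sum>j\<in>levels. rate j * card V) / m"
    by (simp add: expectation_card_level)
  also have "\<dots> \<le> (\<Sum>j\<in>levels. 16 * real b / real s * card V) / m"
    using rate_level(2) by (intro divide_right_mono sum_mono mult_right_mono) auto
  also have "\<dots> \<le> (L * (16 * real b / real s * card V)) / m"
  proof (intro divide_right_mono)
    have "card levels * (16 * real b / real s * card V) \<le> L * (16 * real b / real s * card V)"
      using fin(2) by (intro mult_right_mono) auto
    then show "(\<Sum>j\<in>levels. 16 * real b / real s * card V) \<le> L * (16 * real b / real s * card V)"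
      by simp
  qed simp
  also have "\<dots> \<le> 1 / 8"
  proof -
    have "128 * real L * real (card V) * real b \<le> real m * real s"
      using m_ge by (metis of_nat_le_iff of_nat_mult of_nat_numeral)
    then show ?thesis using m_pos s_pos by (simp add: field_simps)
  qed
  finally show ?thesis .
qed

lemma prob_UN_high_le:
  assumes "\<And>v. v \<in> V \<Longrightarrow> high E v \<Longrightarrow> measure_pmf.prob centers_pmf (B v) \<le> (1 / 2) ^ b"
  shows "measure_pmf.prob centers_pmf (\<Union>v\<in>{v \<in> V. high E v}. B v) \<le> 1 / 8"
proof -
  let ?H = "{v \<in> V. high E v}"
  have "measure_pmf.prob centers_pmf (\<Union>v\<in>?H. B v) \<le> (\<Sum>v\<in>?H. measure_pmf.prob centers_pmf (B v))"
    using finite_V by (intro measure_pmf.finite_measure_subadditive_finite) auto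
  also have "\<dots> \<le> (\<Sum>v\<in>?H. (1 / 2) ^ b)" using assms by (intro sum_mono) auto
  also have "\<dots> = card ?H * (1 / 2) ^ b" by simp
  also have "\<dots> \<le> card V * (1 / 2) ^ b"
    using finite_V by (intro mult_right_mono) (auto intro: card_mono)
  also have "\<dots> \<le> 1 / 8"
  proof -
    have "8 * real (card V) \<le> 2 ^ b" using b_ge by (metis of_nat_le_iff of_nat_mult of_nat_numeral of_nat_power)
    then show ?thesis by (simp add: power_one_over field_simps)
  qed
  finally show ?thesis .
qed

section \<open>Survival of a fixed nontrivial minimum cut\<close>

context
  fixes E S
  assumes G: "graph_on V E" and S: "is_min_cut V E unit_weight S"
    and no_singleton: "\<And>u. u \<in> V \<Longrightarrow> \<not> is_min_cut V E unit_weight {u}"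
begin

definition total_crossing :: "(nat \<times> nat \<Rightarrow> bool) \<Rightarrow> real" where
  "total_crossing R = (\<Sum>v\<in>{v \<in> V. high E v}. real (card (crossing E S v \<inter> level R (lv E v))))"

definition good :: "(nat \<times> nat \<Rightarrow> bool) set" where
  "good = {R. card (centers R) \<le> m \<and>
    (\<forall>v\<in>{v \<in> V. high E v}. card (hits R E v) \<le> s \<and> b \<le> card (same_side E S v \<inter> level R (lv E v))) \<and>
    total_crossing R \<le> 256 * real b}"

lemma sides_subset: "same_side E S v \<subseteq> V" "crossing E S v \<subseteq> V"
  using nbrs_subset[OF G, of v] by (auto simp: same_side_def crossing_def)

lemma sum_crossing_ratio: "(\<Sum>v\<in>{v \<in> V. high E v}. card (crossing E S v) / card (nbrs E v)) \<le> 2"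
proof -
  let ?H = "{v \<in> V. high E v}"
  have SV: "S \<subseteq> V" using S by (auto simp: is_min_cut_def)
  have nonneg: "0 \<le> cut E S" using cut_eq_sum_crossing[OF G SV] by (simp add: sum_nonneg)
  show ?thesis
  \<comment> \<open>The comparison of each degree with the cut value divides by the latter. In a
    disconnected graph it is zero, and then no vertex has a crossing neighbour.\<close>
  proof (cases "cut E S = 0")
    case True
    then have "(\<Sum>v\<in>V. real (card (crossing E S v))) = 0" using sum_crossing[OF G SV] by simp
    then have "\<forall>v\<in>V. real (card (crossing E S v)) = 0"
      using finite_V by (subst (asm) sum_nonneg_eq_0_iff) auto
    then have "(\<Sum>v\<in>?H. card (crossing E S v) / card (nbrs E v)) = 0" by (intro sum.neutral) auto
    then show ?thesis by simp
  next
    case False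
    then have pos: "0 < cut E S" using nonneg by simp
    have "(\<Sum>v\<in>?H. card (crossing E S v) / card (nbrs E v)) \<le> (\<Sum>v\<in>?H. card (crossing E S v) / cut E S)"
      using min_cut_le_degree[OF G card_V_ge S] pos
      by (intro sum_mono divide_left_mono) (auto intro!: mult_pos_pos intro: less_le_trans)
    also have "\<dots> \<le> (\<Sum>v\<in>V. card (crossing E S v) / cut E S)"
      using finite_V pos by (intro sum_mono2) auto
    also have "\<dots> = 2"
      using sum_crossing[OF G SV] pos by (simp flip: sum_divide_distrib)
    finally show ?thesis .
  qed
qed

text \<open>The rate at the level of \<open>v\<close> is at most \<open>16 * b\<close> divided by
  the degree of \<open>v\<close>, so the expectation is at most \<open>32 * b\<close> by
  \<open>sum_crossing_ratio\<close>. Markov with failure probability 1/8 turns this into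
  \<open>256 * b\<close>.\<close>

lemma large_total_crossing:
  "measure_pmf.prob centers_pmf {R. 256 * real b < total_crossing R} \<le> 1 / 8"
proof -
  let ?H = "{v \<in> V. high E v}"
  have "measure_pmf.prob centers_pmf {R. 256 * real b < total_crossing R} \<le>
      measure_pmf.expectation centers_pmf (\<lambda>R. total_crossing R / (256 * real b))"
    using b_pos by (intro prob_le_expectation) (auto simp: total_crossing_def sum_nonneg)
  also have "\<dots> = (\<Sum>v\<in>?H. rate (lv E v) * card (crossing E S v)) / (256 * real b)"
    using lv_bounds(1)[OF G] sides_subset(2) by (simp add: total_crossing_def expectation_card_level)
  also have "\<dots> \<le> (\<Sum>v\<in>?H. 16 * real b * (card (crossing E S v) / card (nbrs E v))) / (256 * real b)"
  proof (intro divide_right_mono sum_mono)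
    fix v assume v: "v \<in> ?H"
    then have d: "0 < card (nbrs E v)" by (auto simp: high_def)
    have "card (nbrs E v) < 2 * 2 ^ lv E v" using lv_bounds(3)[OF G, of v] v by simp
    then have "real (card (nbrs E v)) < 2 * 2 ^ lv E v"
      by (metis of_nat_less_iff of_nat_mult of_nat_numeral of_nat_power)
    then have "8 * real b / 2 ^ lv E v \<le> 8 * real b / (real (card (nbrs E v)) / 2)"
      using d by (intro divide_left_mono) auto
    then have "rate (lv E v) \<le> 16 * real b / card (nbrs E v)"
      using rate_level(1)[OF lv_bounds(1)[OF G, of v]] v by simp
    then have "rate (lv E v) * card (crossing E S v) \<le> 16 * real b / card (nbrs E v) * card (crossing E S v)"
      by (rule mult_right_mono) simp
    then show "rate (lv E v) * card (crossing E S v) \<le> 16 * real b * (card (crossing E S v) / card (nbrs E v))"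
      by simp
  qed simp
  also have "\<dots> = (\<Sum>v\<in>?H. card (crossing E S v) / card (nbrs E v)) / 16"
    using b_pos by (simp only: sum_distrib_left[symmetric]) simp
  also have "\<dots> \<le> 1 / 8" using sum_crossing_ratio by simp
  finally show ?thesis .
qed

text \<open>There are four ways to violate \<open>good\<close>, each of probability at most 1/8;
  this budget is the source of the factors 8 in the parameters.\<close>

lemma prob_good: "1 / 2 \<le> measure_pmf.prob centers_pmf good"
proof -
  let ?H = "{v \<in> V. high E v}"
  let ?A1 = "{R. m < card (centers R)}"
  let ?A2 = "\<Union>v\<in>?H. {R. s < card (nbrs E v \<inter> level R (lv E v))}"
  let ?A3 = "\<Union>v\<in>?H. {R. card (same_side E S v \<inter> level R (lv E v)) < b}"
  let ?A4 = "{R. 256 * real b < total_crossing R}"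
  have A2: "measure_pmf.prob centers_pmf ?A2 \<le> 1 / 8"
  proof (rule prob_UN_high_le)
    fix v assume "v \<in> V" "high E v"
    then show "measure_pmf.prob centers_pmf {R. s < card (nbrs E v \<inter> level R (lv E v))} \<le> (1 / 2) ^ b"
      using lv_bounds[OF G, of v] nbrs_subset[OF G] by (intro many_hits) auto
  qed
  have A3: "measure_pmf.prob centers_pmf ?A3 \<le> 1 / 8"
  proof (rule prob_UN_high_le)
    fix v assume v: "v \<in> V" "high E v"
    have "card (nbrs E v) \<le> 2 * card (same_side E S v)"
      using crossing_le_same_side[OF G S no_singleton v(1)] card_nbrs_split[OF G, of v S] by simp
    then show "measure_pmf.prob centers_pmf {R. card (same_side E S v \<inter> level R (lv E v)) < b} \<le> (1 / 2) ^ b"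
      using lv_bounds[OF G v(2)] sides_subset by (intro few_hits) auto
  qed
  have "- good = ?A1 \<union> ?A2 \<union> ?A3 \<union> ?A4"
    by (auto simp: good_def hits_def not_le)
  then have "measure_pmf.prob centers_pmf (- good) = measure_pmf.prob centers_pmf (?A1 \<union> ?A2 \<union> ?A3 \<union> ?A4)"
    by simp
  also have "\<dots> \<le> measure_pmf.prob centers_pmf ?A1 + measure_pmf.prob centers_pmf ?A2 +
      measure_pmf.prob centers_pmf ?A3 + measure_pmf.prob centers_pmf ?A4"
    by (intro order_trans[OF measure_Un_le] add_mono order_refl) simp_all
  also have "\<dots> \<le> 1 / 8 + 1 / 8 + 1 / 8 + 1 / 8"
    by (intro add_mono many_centers A2 A3 large_total_crossing)
  finally show ?thesis
    using measure_pmf.prob_compl[of good centers_pmf] by (simp add: Compl_eq_Diff_UNIV)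
qed

text \<open>Given the centres, the vertices choose independently. A vertex with \<open>g\<close> centres on its own side
  and \<open>c\<close> on the other side stays on its side with probability \<open>g / (g + c) \<ge> exp (- c / g)\<close>.\<close>

lemma prob_choice:
  assumes R: "R \<in> good"
  shows "exp (- 256) \<le> measure_pmf.prob choice_pmf
    {\<rho>. \<forall>v\<in>{v \<in> V. high E v}. \<rho> (v, hits R E v) \<in> same_side E S v \<inter> hits R E v}"
proof -
  let ?H = "{v \<in> V. high E v}"
  let ?I = "V \<times> (Pow V - {{}})"
  let ?key = "\<lambda>v. (v, hits R E v)"
  \<comment> \<open>Only the keys that are actually looked up are constrained; every other
    coordinate contributes a factor 1 to the product.\<close>
  define B where "B i = (if i \<in> ?key ` ?H then same_side E S (fst i) \<inter> snd i else UNIV)" for i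
  define c where "c v = real (card (crossing E S v \<inter> level R (lv E v)))" for v
  have good: "b \<le> card (same_side E S v \<inter> level R (lv E v))" if "v \<in> ?H" for v
    using R that by (simp add: good_def)
  have hits_V: "hits R E v \<subseteq> V" "finite (hits R E v)" for v
    using nbrs_subset[OF G, of v] finite_nbrs[OF G, of v] by (auto simp: hits_def)
  have hits_split: "same_side E S v \<inter> hits R E v = same_side E S v \<inter> level R (lv E v)" for v
    by (auto simp: hits_def same_side_def)
  have ne: "hits R E v \<noteq> {}" if "v \<in> ?H" for v
    using good[OF that] b_pos hits_split[of v] by auto
  have card_hits: "card (hits R E v) = card (same_side E S v \<inter> hits R E v) + card (crossing E S v \<inter> level R (lv E v))" for v
  proof -
    have "hits R E v = (same_side E S v \<inter> hits R E v) \<union> (crossing E S v \<inter> level R (lv E v))"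
      by (auto simp: hits_def same_side_def crossing_def)
    moreover have "(same_side E S v \<inter> hits R E v) \<inter> (crossing E S v \<inter> level R (lv E v)) = {}"
      by (auto simp: same_side_def crossing_def)
    moreover have "finite (crossing E S v \<inter> level R (lv E v))"
      using finite_subset[OF sides_subset(2) finite_V] by simp
    ultimately show ?thesis using hits_V(2)[of v] by (metis card_Un_disjoint finite_Int)
  qed
  have keys: "?key ` ?H \<subseteq> ?I" using hits_V(1) ne by auto
  \<comment> \<open>Distinct vertices consult distinct coordinates even when their hits coincide,
    which is why their choices are independent.\<close>
  have inj: "inj_on ?key ?H" by (auto simp: inj_on_def)
  have "exp (- 256) \<le> exp (- (total_crossing R / b))"
    using R b_pos by (simp add: good_def field_simps)
  also have "\<dots> = exp (\<Sum>v\<in>?H. - (c v / b))"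
    by (simp add: total_crossing_def c_def sum_negf flip: sum_divide_distrib)
  also have "\<dots> = (\<Prod>v\<in>?H. exp (- (c v / b)))"
    using finite_V by (intro exp_sum) simp
  also have "\<dots> \<le> (\<Prod>v\<in>?H. measure_pmf.prob (pmf_of_set (hits R E v)) (same_side E S v \<inter> hits R E v))"
  proof (rule prod_mono)
    fix v assume v: "v \<in> ?H"
    let ?g = "real (card (same_side E S v \<inter> hits R E v))"
    have "exp (- (c v / b)) \<le> ?g / (?g + c v)"
      using good[OF v] b_pos by (intro ratio_ge_exp) (auto simp: hits_split c_def)
    also have "?g + c v = real (card (hits R E v))" by (simp add: card_hits[of v] c_def)
    also have "?g / \<dots> = measure_pmf.prob (pmf_of_set (hits R E v)) (same_side E S v \<inter> hits R E v)"
      using ne[OF v] hits_V(2)[of v] by (simp add: measure_pmf_of_set Int_ac)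
    finally show "0 \<le> exp (- (c v / b)) \<and> exp (- (c v / b)) \<le>
        measure_pmf.prob (pmf_of_set (hits R E v)) (same_side E S v \<inter> hits R E v)" by simp
  qed
  also have "\<dots> = (\<Prod>i\<in>?key ` ?H. measure_pmf.prob (pmf_of_set (snd i)) (B i))"
    by (subst prod.reindex[OF inj]) (auto simp: B_def intro!: prod.cong)
  also have "\<dots> = (\<Prod>i\<in>?I. measure_pmf.prob (pmf_of_set (snd i)) (B i))"
    using finite_V keys by (intro prod.mono_neutral_left) (auto simp: B_def)
  also have "\<dots> = measure_pmf.prob choice_pmf (Pi ?I B)"
    unfolding choice_pmf_def using finite_V by (intro measure_Pi_pmf_Pi[symmetric]) simp
  also have "\<dots> \<le> measure_pmf.prob choice_pmf
      {\<rho>. \<forall>v\<in>?H. \<rho> (v, hits R E v) \<in> same_side E S v \<inter> hits R E v}"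
  proof (intro measure_pmf.finite_measure_mono subsetI CollectI ballI)
    fix \<rho> v assume \<rho>: "\<rho> \<in> Pi ?I B" and v: "v \<in> ?H"
    have "?key v \<in> ?I" using keys v by blast
    then have "\<rho> (?key v) \<in> B (?key v)" using \<rho> by (rule Pi_mem[rotated])
    then show "\<rho> (v, hits R E v) \<in> same_side E S v \<inter> hits R E v" using v by (simp add: B_def)
  qed simp
  finally show ?thesis .
qed

lemma good_choice_succeeds:
  assumes R: "R \<in> good"
    and \<rho>: "\<forall>v\<in>{v \<in> V. high E v}. \<rho> (v, hits R E v) \<in> same_side E S v \<inter> hits R E v"
  shows "S \<in> candidates (R, \<rho>) E"
proof -
  have "ok (R, \<rho>) E" using R \<rho> by (auto simp: ok_def good_def)
  moreover have "v \<in> S \<longleftrightarrow> rep (R, \<rho>) E v \<in> S" if "v \<in> V" for v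
    using \<rho> that by (auto simp: rep_def same_side_def)
  ultimately show ?thesis using S by (auto simp: candidates_def is_min_cut_def)
qed

lemma prob_nontrivial_min_cut:
  "1 / 2 * exp (- 256) \<le> measure_pmf.prob trial_pmf {r. \<exists>T\<in>candidates r E. is_min_cut V E unit_weight T}"
  unfolding trial_pmf_def
proof (rule prob_bind_pmf_ge[OF prob_good])
  fix R assume R: "R \<in> good"
  have "exp (- 256) \<le> measure_pmf.prob choice_pmf
    {\<rho>. \<forall>v\<in>{v \<in> V. high E v}. \<rho> (v, hits R E v) \<in> same_side E S v \<inter> hits R E v}"
    by (rule prob_choice[OF R])
  also have "\<dots> \<le> measure_pmf.prob choice_pmf
      (Pair R -` {r. \<exists>T\<in>candidates r E. is_min_cut V E unit_weight T})"
    using good_choice_succeeds[OF R] S by (intro measure_pmf.finite_measure_mono) auto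
  finally show "exp (- 256) \<le> measure_pmf.prob (map_pmf (Pair R) choice_pmf)
      {r. \<exists>T\<in>candidates r E. is_min_cut V E unit_weight T}"
    by simp
qed simp

end

lemma trial_succeeds:
  assumes G: "graph_on V E"
  shows "1 / 2 * exp (- 256) \<le> measure_pmf.prob trial_pmf {r. \<exists>S\<in>candidates r E. is_min_cut V E unit_weight S}"
proof (cases "\<exists>u\<in>V. is_min_cut V E unit_weight {u}")
  case True
  then have "{r. \<exists>S\<in>candidates r E. is_min_cut V E unit_weight S} = UNIV"
    by (auto simp: candidates_def)
  moreover have "exp (- 256) \<le> (1::real)" by simp
  then have "1 / 2 * exp (- 256) \<le> (1::real)" by linarith
  ultimately show ?thesis by simp
next
  case False
  obtain S where "is_min_cut V E unit_weight S" using exists_min_cut[OF finite_V card_V_ge] by blast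
  then show ?thesis using prob_nontrivial_min_cut[OF G] False by blast
qed

lemma boosted_star_contraction:
  assumes T: "0 < T"
  shows "\<exists>D. \<forall>E. graph_on V E \<longrightarrow>
    (\<forall>A\<in>set_pmf D. queries_within V (cut E) A \<and> round_count (cut E) A \<le> 2 \<and>
      query_count (cut E) A \<le> T * (card V * ((1 + L) * (3 * length Bs)) + m * m)) \<and>
    measure_pmf.prob D {A. finds_min_cut V E unit_weight A} \<ge> 1 - (1 - 1 / 2 * exp (- 256)) ^ T"
proof (rule two_round_boost[where P = trial_pmf and cand = candidates and ?q1.0 = queries1 and ?q2.0 = queries2])
  have "exp (- 256) \<le> (1::real)" by simp
  then show "1 / 2 * exp (- 256) \<le> (1::real)" by linarith
  show "length (queries1 r) \<le> card V * ((1 + L) * (3 * length Bs))" for r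
    by (simp add: length_queries1)
  show "length (queries2 r E) \<le> m * m" for r E by (rule length_queries2)
  show "S \<subseteq> V" if "S \<in> set (queries1 r)" for r S using that by (rule queries1_subset)
  show "S \<subseteq> V" if "S \<in> set (queries2 r E)" for r E S using that by (rule queries2_subset)
  show "queries2 r E = queries2 r E'" "candidates r E = candidates r E'"
    if "graph_on V E" "graph_on V E'" "agree (queries1 r) E E'" for r E E'
    using that by (rule agree_queries2_candidates)+
qed (fact cut_candidates_agree candidates_proper candidates_nonempty trial_succeeds T)+

end

section \<open>Choice of the parameters\<close>

definition log_size :: "nat \<Rightarrow> nat" where
  "log_size n = Suc (floor_log n)"

definition cube_root :: "nat \<Rightarrow> nat" where
  "cube_root n = nat \<lceil>real n powr (1/3)\<rceil>"

text \<open>The summand beyond the cube root is \<open>32 * b\<close> for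
  \<open>b = log_size n + 3\<close>, as the upper tail bound demands.\<close>

definition sparsity :: "nat \<Rightarrow> nat" where
  "sparsity n = cube_root n + 32 * (log_size n + 3)"

text \<open>Solves \<open>128 * L * n * b \<le> m * s\<close> using that \<open>n\<close> is at most
  the cube of \<open>cube_root n\<close>, and \<open>s\<close> at least
  \<open>cube_root n\<close>.\<close>

definition max_centers :: "nat \<Rightarrow> nat" where
  "max_centers n = 128 * log_size n * (log_size n + 3) * cube_root n ^ 2"

text \<open>A trial succeeds with probability at least \<open>c = exp (- 256) / 2\<close>, and
  \<open>4 * exp 256\<close> is \<open>2 / c\<close>; the failure probability is thus at most
  \<open>exp (- 2 * log_size n)\<close>.\<close>

definition trials :: "nat \<Rightarrow> nat" where
  "trials n = nat \<lceil>4 * exp 256 :: real\<rceil> * log_size n"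

definition query_bound :: "nat \<Rightarrow> nat" where
  "query_bound n = trials n * (n * ((1 + log_size n) * (3 * (2 * sparsity n * log_size n + 2)))
     + max_centers n * max_centers n)"

lemma less_two_power_log_size: "n < 2 ^ log_size n"
  by (simp add: log_size_def floor_log_exp2_gt)

lemma le_cube_root_power: "n \<le> cube_root n ^ 3"
proof -
  have "real n = (real n powr (1/3)) ^ 3"
    by (cases "n = 0") (simp_all add: powr_powr flip: powr_realpow)
  also have "\<dots> \<le> real (cube_root n) ^ 3"
    by (intro power_mono) (auto simp: cube_root_def intro: real_nat_ceiling_ge)
  finally show ?thesis by (metis of_nat_le_iff of_nat_power)
qed

lemma failure_le:
  assumes "2 \<le> n"
  shows "(1 - 1 / 2 * exp (- 256)) ^ trials n \<le> 1 / real n ^ 2"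
proof -
  define c :: real where "c = 1 / 2 * exp (- 256)"
  have "exp (- 256) \<le> (1::real)" by simp
  then have c: "0 < c" "c \<le> 1" unfolding c_def by (simp, linarith)
  have "2 = c * (4 * exp 256)" by (simp add: c_def exp_minus)
  also have "\<dots> \<le> c * real (nat \<lceil>4 * exp 256 :: real\<rceil>)"
    using c by (intro mult_left_mono real_nat_ceiling_ge) auto
  finally have "2 * real (log_size n) \<le> c * real (nat \<lceil>4 * exp 256 :: real\<rceil>) * log_size n"
    by (rule mult_right_mono) simp
  then have T: "2 * real (log_size n) \<le> c * trials n" by (simp add: trials_def)
  have "(1 - c) ^ trials n \<le> exp (- c) ^ trials n"
    using c exp_ge_add_one_self[of "- c"] by (intro power_mono) auto
  also have "\<dots> = exp (- (c * trials n))" by (simp flip: exp_of_nat_mult add: mult_ac)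
  also have "\<dots> \<le> exp (- (2 * real (log_size n)))" using T by simp
  also have "\<dots> = inverse ((exp 1 ^ log_size n) ^ 2)"
    by (simp add: exp_minus flip: exp_of_nat_mult power_mult)
  also have "\<dots> \<le> inverse (real n ^ 2)"
  proof (intro le_imp_inverse_le power_mono)
    have "real n \<le> 2 ^ log_size n"
      using less_two_power_log_size[of n] by (metis less_imp_le of_nat_le_iff of_nat_numeral of_nat_power)
    also have "\<dots> \<le> exp 1 ^ log_size n"
      using exp_ge_add_one_self[of "1::real"] by (intro power_mono) auto
    finally show "real n \<le> exp 1 ^ log_size n" .
  qed (use assms in auto)
  finally show ?thesis by (simp add: c_def inverse_eq_divide)
qed

text \<open>Both rounds contribute the fourth power of the cube root \<open>K\<close>: the first as
  \<open>n * s\<close> with \<open>n \<le> K ^ 3\<close>, the second as the square of about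
  \<open>K ^ 2\<close> centres. The number of trials adds the fifth logarithm.\<close>

lemma query_bound_le:
  assumes "2 \<le> n"
  shows "query_bound n \<le> nat \<lceil>4 * exp 256 :: real\<rceil> * 300000 * (cube_root n ^ 4 * log_size n ^ 5)"
proof -
  define K L C where "K = cube_root n" and "L = log_size n" and "C = nat \<lceil>4 * exp 256 :: real\<rceil>"
  have L1: "1 \<le> L" by (simp add: L_def log_size_def)
  have n: "n \<le> K ^ 3" unfolding K_def by (rule le_cube_root_power)
  then have K1: "1 \<le> K" using assms by (cases K) auto
  have KL: "L \<le> K * L" "K \<le> K * L" "1 \<le> K * L" using K1 L1 by simp_all
  have s: "sparsity n \<le> 129 * (K * L)"
  proof -
    have "K + 32 * (L + 3) \<le> K * L + 32 * (K * L + 3 * (K * L))"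
      by (intro add_mono mult_le_mono KL order_refl) (use K1 L1 in auto)
    then show ?thesis by (simp add: sparsity_def flip: K_def L_def)
  qed
  have "2 * sparsity n * L + 2 \<le> 2 * (129 * (K * L)) * L + 2 * (K * L * L)"
    using s K1 L1 by (intro add_mono mult_le_mono) auto
  then have len: "2 * sparsity n * L + 2 \<le> 260 * (K * L ^ 2)" by (simp add: power2_eq_square)
  have "n * ((1 + L) * (3 * (2 * sparsity n * L + 2))) \<le> K ^ 3 * (2 * L * (3 * (260 * (K * L ^ 2))))"
    using n len L1 by (intro mult_le_mono) auto
  also have "\<dots> = 1560 * (K ^ 4 * L ^ 3)" by (simp add: power_numeral_reduce)
  also have "\<dots> \<le> 1560 * (K ^ 4 * L ^ 4)"
    using L1 by (intro mult_le_mono power_increasing order_refl) auto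
  finally have first: "n * ((1 + L) * (3 * (2 * sparsity n * L + 2))) \<le> 1560 * (K ^ 4 * L ^ 4)" .
  have mc: "max_centers n \<le> 128 * L * (4 * L) * K ^ 2"
    unfolding max_centers_def K_def[symmetric] L_def[symmetric] using L1 by (intro mult_le_mono) auto
  have "max_centers n * max_centers n \<le> (128 * L * (4 * L) * K ^ 2) * (128 * L * (4 * L) * K ^ 2)"
    by (rule mult_le_mono[OF mc mc])
  also have "\<dots> = 262144 * (K ^ 4 * L ^ 4)" by (simp add: power_numeral_reduce)
  finally have second: "max_centers n * max_centers n \<le> 262144 * (K ^ 4 * L ^ 4)" .
  have "query_bound n \<le> C * L * (1560 * (K ^ 4 * L ^ 4) + 262144 * (K ^ 4 * L ^ 4))"
    unfolding query_bound_def trials_def L_def[symmetric] C_def[symmetric]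
    by (intro mult_le_mono add_mono first second) auto
  also have "\<dots> = C * 263704 * (K ^ 4 * L ^ 5)" by (simp add: power_numeral_reduce)
  also have "\<dots> \<le> C * 300000 * (K ^ 4 * L ^ 5)" by (intro mult_le_mono) auto
  finally show ?thesis by (simp add: K_def L_def C_def)
qed

section \<open>Asymptotics of the query bound\<close>

lemma cube_root_le:
  assumes "1 \<le> n"
  shows "real (cube_root n) \<le> 2 * real n powr (1/3)"
proof -
  have "1 \<le> real n powr (1/3)" using assms by (intro ge_one_powr_ge_zero) auto
  moreover have "real (cube_root n) \<le> real n powr (1/3) + 1"
    unfolding cube_root_def using of_int_ceiling_le_add_one[of "real n powr (1/3)"] by simp
  ultimately show ?thesis by linarith
qed

text \<open>Since \<open>ln 2 \<ge> 1 / 2\<close>, both the floored logarithm and the added 1 are at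
  most \<open>2 * ln n\<close>.\<close>

lemma log_size_le:
  assumes "2 \<le> n"
  shows "real (log_size n) \<le> 4 * ln (real n)"
proof -
  have e: "exp (1 / 2) \<le> (2::real)"
  proof -
    have "exp (1/2) ^ 2 = exp (1::real)" by (simp flip: exp_of_nat_mult)
    then have "exp (1/2) ^ 2 \<le> (2::real) ^ 2" using exp_le by simp
    then show ?thesis by (rule power2_le_imp_le) simp
  qed
  have "1 / 2 = ln (exp (1 / 2 :: real))" by simp
  also have "\<dots> \<le> ln 2" using e by (subst ln_le_cancel_iff) auto
  finally have ln2: "1 / 2 \<le> ln (2::real)" .
  have "2 ^ floor_log n \<le> n" using assms by (intro floor_log_exp2_le) simp
  then have "(2::real) ^ floor_log n \<le> real n" by (metis of_nat_le_iff of_nat_numeral of_nat_power)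
  then have "ln ((2::real) ^ floor_log n) \<le> ln (real n)" using assms by (subst ln_le_cancel_iff) auto
  then have "real (floor_log n) * ln 2 \<le> ln (real n)" by (simp add: ln_realpow)
  moreover have "real (floor_log n) * (1 / 2) \<le> real (floor_log n) * ln 2"
    using ln2 by (intro mult_left_mono) auto
  moreover have "ln 2 \<le> ln (real n)" using assms by (subst ln_le_cancel_iff) auto
  ultimately show ?thesis using ln2 by (simp add: log_size_def)
qed

lemma query_bound_soft_O: "(\<lambda>n. real (query_bound n)) \<in> soft_O (\<lambda>n. real n powr (4/3))"
proof -
  define C where "C = nat \<lceil>4 * exp 256 :: real\<rceil> * 300000"
  have bound: "real (query_bound n) \<le> real C * 16 * 1024 * (real n powr (4/3) * ln (real n) ^ 5)"
    if n: "2 \<le> n" for n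
  proof -
    have ln0: "0 \<le> ln (real n)" using n by simp
    have "real (query_bound n) \<le> real (C * (cube_root n ^ 4 * log_size n ^ 5))"
      using query_bound_le[OF n] unfolding C_def by (subst of_nat_le_iff) simp
    also have "\<dots> = real C * (real (cube_root n) ^ 4 * real (log_size n) ^ 5)" by simp
    also have "\<dots> \<le> real C * ((2 * real n powr (1/3)) ^ 4 * (4 * ln (real n)) ^ 5)"
      using cube_root_le[of n] log_size_le[OF n] n ln0
      by (intro mult_left_mono mult_mono power_mono) auto
    also have "(real n powr (1/3)) ^ 4 = real n powr (4/3)"
      using n by (simp add: powr_powr flip: powr_realpow)
    then have "real C * ((2 * real n powr (1/3)) ^ 4 * (4 * ln (real n)) ^ 5) =
        real C * 16 * 1024 * (real n powr (4/3) * ln (real n) ^ 5)"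
      by (simp add: power_mult_distrib)
    finally show ?thesis .
  qed
  have "(\<lambda>n. real (query_bound n)) \<in> O(\<lambda>n. real n powr (4/3) * ln (real n) ^ 5)"
  proof (rule bigoI)
    show "\<forall>\<^sub>F n in sequentially. norm (real (query_bound n)) \<le>
        (real C * 16 * 1024) * norm (real n powr (4/3) * ln (real n) ^ 5)"
      using eventually_ge_at_top[of 2]
    proof eventually_elim
      case (elim n)
      have "norm (real n powr (4/3) * ln (real n) ^ 5) = real n powr (4/3) * ln (real n) ^ 5"
        using elim by (simp add: abs_mult)
      then show ?case using bound[OF elim] by simp
    qed
  qed
  then show ?thesis by (auto simp: soft_O_def)
qed

text \<open>The sets \<open>Bs\<close> and the random trials depend on \<open>V\<close> only, so one
  distribution \<open>D\<close> serves all edge sets.\<close>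

lemma exists_min_cut_algorithm:
  fixes V :: "nat set"
  assumes V: "finite V" "2 \<le> card V"
  shows "\<exists>D. \<forall>E. graph_on V E \<longrightarrow>
    (\<forall>A\<in>set_pmf D. queries_within V (cut E) A \<and> round_count (cut E) A \<le> 2 \<and>
      query_count (cut E) A \<le> query_bound (card V)) \<and>
    measure_pmf.prob D {A. finds_min_cut V E unit_weight A} \<ge> 1 - 1 / real (card V) ^ 2"
proof -
  let ?n = "card V"
  let ?L = "log_size ?n" and ?s = "sparsity ?n" and ?m = "max_centers ?n"
  have L: "?n < 2 ^ ?L" by (rule less_two_power_log_size)
  then have "?n + 1 \<le> 2 ^ ?L" by simp
  from exists_sparse_recovery[OF V(1) this, of ?s] obtain Bs where
    len: "length Bs = 2 * ?s * ?L + 2" and Bs: "V \<in> set Bs" "\<forall>B\<in>set Bs. B \<subseteq> V"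
    "\<forall>N N'. N \<subseteq> V \<longrightarrow> N' \<subseteq> V \<longrightarrow> card N \<le> ?s \<longrightarrow>
      (\<forall>B\<in>set Bs. card (N \<inter> B) = card (N' \<inter> B)) \<longrightarrow> N = N'"
    by auto
  \<comment> \<open>The 3 in \<open>?L + 3\<close> pays for the factor 8 in the union bound over
    \<open>V\<close>.\<close>
  interpret star_trials V ?s ?m ?L Bs "?L + 3"
  proof
    show "8 * ?n \<le> 2 ^ (?L + 3)" using L by (simp add: power_add)
    show "32 * (?L + 3) \<le> ?s" by (simp add: sparsity_def)
    have "128 * ?L * ?n * (?L + 3) \<le> 128 * ?L * cube_root ?n ^ 3 * (?L + 3)"
      using le_cube_root_power by (intro mult_le_mono) auto
    also have "\<dots> = ?m * cube_root ?n" by (simp add: max_centers_def power_numeral_reduce)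
    also have "\<dots> \<le> ?m * ?s" by (intro mult_le_mono) (simp_all add: sparsity_def)
    finally show "128 * ?L * ?n * (?L + 3) \<le> ?m * ?s" .
    show "B \<subseteq> V" if "B \<in> set Bs" for B using Bs(2) that by blast
    show "N = N'" if "N \<subseteq> V" "N' \<subseteq> V" "card N \<le> ?s"
      "\<forall>B\<in>set Bs. card (N \<inter> B) = card (N' \<inter> B)" for N N'
      using Bs(3)[rule_format, OF that(1-3)] that(4) by simp
  qed (fact V L Bs(1))+
  have "0 < nat \<lceil>4 * exp 256 :: real\<rceil>" by simp
  then have "0 < trials ?n" by (simp add: trials_def log_size_def)
  from boosted_star_contraction[OF this] obtain D where D: "\<And>E. graph_on V E \<Longrightarrow>
    (\<forall>A\<in>set_pmf D. queries_within V (cut E) A \<and> round_count (cut E) A \<le> 2 \<and>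
      query_count (cut E) A \<le> query_bound ?n) \<and>
    measure_pmf.prob D {A. finds_min_cut V E unit_weight A} \<ge> 1 - (1 - 1 / 2 * exp (- 256)) ^ trials ?n"
    by (auto simp: query_bound_def len)
  show ?thesis
  proof (intro exI[of _ D] allI impI)
    fix E assume "graph_on V E"
    from D[OF this] show "(\<forall>A\<in>set_pmf D. queries_within V (cut E) A \<and> round_count (cut E) A \<le> 2 \<and>
      query_count (cut E) A \<le> query_bound ?n) \<and>
      measure_pmf.prob D {A. finds_min_cut V E unit_weight A} \<ge> 1 - 1 / real ?n ^ 2"
      using failure_le[OF V(2)] by linarith
  qed
qed

theorem mainTheorem1:
  "\<exists>q :: nat \<Rightarrow> nat.
     (\<lambda>n. real (q n)) \<in> soft_O (\<lambda>n. real n powr (4/3)) \<and>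
     (\<forall>V :: nat set. finite V \<and> card V \<ge> 2 \<longrightarrow>
       (\<exists>D :: (nat, nat set \<times> real) query_alg pmf.
         \<forall>E. is_graph V E unit_weight \<longrightarrow>
           (\<forall>A\<in>set_pmf D.
              queries_within V (cut_value E unit_weight) A \<and>
              round_count (cut_value E unit_weight) A \<le> 2 \<and>
              query_count (cut_value E unit_weight) A \<le> q (card V)) \<and>
           measure_pmf.prob D {A. finds_min_cut V E unit_weight A}
             \<ge> 1 - 1 / real (card V) ^ 2))"
  using query_bound_soft_O exists_min_cut_algorithm by blast

end
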